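(* Let $\mathbb{K}=\mathbb{R}$ or $\mathbb{C}$, fix the kind of scalar product (bilinear or sesquilinear), let $m\ge n$, let $M\in\mathbb{K}^{m\times m}$ and $N\in\mathbb{K}^{n\times n}$ be nonsingular matrices, and let $\sigma:\mathbb{K}^{n\times n}\to\mathbb{K}^{n\times n}$ be a generalized matrix sign function. A rectangular matrix $F\in\mathbb{K}^{m\times n}$ has a decomposition $$F=WS,$$ where, with $\Sigma=\sigma(F^{[M,N]}F)$, the matrix $S\in\mathbb{K}^{n\times n}$ is $r$-positive-definite, $N$-selfadjoint and $N\Sigma$-selfadjoint, and the matrix $W\in\mathbb{K}^{m\times n}$ has $(M,N\Sigma^{-1})$-orthonormal columns and satisfies $(W^{[M,N]})^{[N,M]}=W$, if and only if $F^{[M,N]}F$ is nonsingular and $(F^{[M,N]})^{[N,M]}=F$. When such a decomposition exists it is unique, with $S$ given by $S=(\Sigma F^{[M,N]}F)^{1/2}$ (principal square root) and $W=FS^{-1}$.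
   Context: Notation. $A^\#=A^T$ if the scalar products are (real or complex) bilinear forms, and $A^\#=\bar A^T$ if they are sesquilinear forms; the same choice is used throughout for all scalar products. For nonsingular $M\in\mathbb{K}^{m\times m}$, $N\in\mathbb{K}^{n\times n}$ and $A\in\mathbb{K}^{m\times n}$, the $(M,N)$-adjoint is $A^{[M,N]}=N^{-1}A^\# M\in\mathbb{K}^{n\times m}$; correspondingly, for $B\in\mathbb{K}^{n\times m}$, $B^{[N,M]}=M^{-1}B^\# N$. For $A\in\mathbb{K}^{n\times n}$, $A^{[N]}=N^{-1}A^\# N$, and $A$ is $N$-selfadjoint if $A^{[N]}=A$, i.e. $A^\# N=NA$ (the same definition is used with $N$ replaced by any nonsingular matrix, e.g. $N\Sigma$). A square matrix is $r$-positive-definite if all of its eigenvalues have positive real part. A matrix $W\in\mathbb{K}^{m\times n}$ has $(M,N)$-orthonormal columns if $W^{[M,N]}W=I_n$, equivalently $W^\# MW=N$ (and likewise with $N$ replaced by any nonsingular matrix, e.g. $N\Sigma^{-1}$). For a matrix $A$ with no eigenvalues in $(-\infty,0]$, $A^{1/2}$ is the principal square root: the unique square root of $A$ whose eigenvalues all lie in the open right half-plane. Primary matrix functions. A stem function $f$ assigns to each $\lambda$ in its domain in $\mathbb{C}$ a value $f(\lambda)=f^{(0)}(\lambda)$ and "derivative" values $f^{(j)}(\lambda)$, $j\ge1$, which may be arbitrarily assigned numbers at each $\lambda$. The associated primary matrix function is $f(A)=Qf(J)Q^{-1}$, where $A=QJQ^{-1}$ is a (complex) Jordan decomposition and $f$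 is applied to each Jordan block: $f(J_s(\lambda))$ is the $s\times s$ upper triangular Toeplitz matrix with $f^{(j)}(\lambda)/j!$ on the $j$-th superdiagonal, $0\le j\le s-1$. A generalized matrix sign function $\sigma:\mathbb{K}^{n\times n}\to\mathbb{K}^{n\times n}$ is a primary matrix function such that for all nonsingular $A\in\mathbb{K}^{n\times n}$: $\sigma(A)A$ has no eigenvalues on the negative real axis, $\sigma(\bar A)=\overline{\sigma(A)}$, and all eigenvalues $\lambda$ of $\sigma(A)$ satisfy $|\lambda|=1$. Such $\sigma$ is defined on nonsingular matrices only (the stem function is left undefined at $0$); any statement that a decomposition involving $\Sigma=\sigma(\cdot)$ exists includes that $\Sigma$ is defined. *)

theory Defs
  imports "Jordan_Normal_Form.Jordan_Normal_Form_Existence"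
begin

text \<open>
  Matrices over \<open>\<real>\<close> are rendered as complex matrices with real entries, so that the real and
  the complex case share one set of definitions, and eigenvalues and Jordan decompositions are
  always the complex ones. The field is the parameter \<open>K\<close>, either \<open>\<real>\<close> or \<open>UNIV\<close>.
\<close>

definition mats_over :: "complex set \<Rightarrow> nat \<Rightarrow> nat \<Rightarrow> complex mat set" where
  "mats_over K m n = {A \<in> carrier_mat m n. elements_mat A \<subseteq> K}"

text \<open>Only meaningful for nonsingular matrices.\<close>

definition mat_inv :: "complex mat \<Rightarrow> complex mat" where
  "mat_inv A = the (mat_inverse A)"

abbreviation mat_cnj :: "complex mat \<Rightarrow> complex mat" where
  "mat_cnj A \<equiv> map_mat cnj A"

datatype scalar_product_kind = Bilinear | Sesquilinear

fun sharp :: "scalar_product_kind \<Rightarrow> complex mat \<Rightarrow> complex mat" where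
  "sharp Bilinear A = transpose_mat A"
| "sharp Sesquilinear A = mat_adjoint A"

text \<open>\<open>adj k M N A\<close> is the \<open>(M, N)\<close>-adjoint of \<open>A\<close>.\<close>

definition adj ::
  "scalar_product_kind \<Rightarrow> complex mat \<Rightarrow> complex mat \<Rightarrow> complex mat \<Rightarrow> complex mat" where
  "adj k M N A = mat_inv N * sharp k A * M"

definition selfadjoint_wrt ::
  "scalar_product_kind \<Rightarrow> complex mat \<Rightarrow> complex mat \<Rightarrow> bool" where
  "selfadjoint_wrt k N A \<longleftrightarrow> adj k N N A = A"

definition orthonormal_columns ::
  "scalar_product_kind \<Rightarrow> complex mat \<Rightarrow> complex mat \<Rightarrow> complex mat \<Rightarrow> bool" where
  "orthonormal_columns k M N W \<longleftrightarrow> adj k M N W * W = 1\<^sub>m (dim_col W)"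

definition r_positive_definite :: "complex mat \<Rightarrow> bool" where
  "r_positive_definite A \<longleftrightarrow> (\<forall>l. eigenvalue A l \<longrightarrow> Re l > 0)"

definition no_eigenvalue_nonpos_real :: "complex mat \<Rightarrow> bool" where
  "no_eigenvalue_nonpos_real A \<longleftrightarrow> (\<forall>l. eigenvalue A l \<longrightarrow> \<not> (Im l = 0 \<and> Re l \<le> 0))"

definition rhp_sqrt :: "complex mat \<Rightarrow> complex mat \<Rightarrow> bool" where
  "rhp_sqrt A X \<longleftrightarrow> X \<in> carrier_mat (dim_row A) (dim_row A) \<and> X * X = A
     \<and> (\<forall>l. eigenvalue X l \<longrightarrow> Re l > 0)"

text \<open>
  A relation rather than a function: \<open>X\<close> is the principal square root of \<open>A\<close>, including the
  requirement on the spectrum of \<open>A\<close> and the uniqueness of \<open>X\<close> among complex matrices.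
\<close>

definition is_principal_sqrt :: "complex mat \<Rightarrow> complex mat \<Rightarrow> bool" where
  "is_principal_sqrt A X \<longleftrightarrow>
     no_eigenvalue_nonpos_real A \<and> rhp_sqrt A X \<and> (\<forall>Y. rhp_sqrt A Y \<longrightarrow> Y = X)"

text \<open>
  A stem function is partial; where it is defined, at \<open>l\<close> say, it supplies the value
  (index \<open>0\<close>) and arbitrarily assigned ``derivatives'' (index \<open>j \<ge> 1\<close>).
\<close>

type_synonym stem_function = "complex \<rightharpoonup> (nat \<Rightarrow> complex)"

definition stem_block :: "stem_function \<Rightarrow> nat \<Rightarrow> complex \<Rightarrow> complex mat" where
  "stem_block f s l =
     mat s s (\<lambda>(i, j). if i \<le> j then the (f l) (j - i) / fact (j - i) else 0)"

definition stem_jordan_matrix :: "stem_function \<Rightarrow> (nat \<times> complex) list \<Rightarrow> complex mat" where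
  "stem_jordan_matrix f n_as = diag_block_mat (map (\<lambda>(s, l). stem_block f s l) n_as)"

text \<open>
  \<open>primary_value f A B\<close> says that \<open>f(A)\<close> is defined and equals \<open>B\<close>. The value does not depend
  on the Jordan decomposition \<open>A = Q * J * Q'\<close>, with \<open>Q'\<close> the inverse of \<open>Q\<close>.
\<close>

definition primary_value :: "stem_function \<Rightarrow> complex mat \<Rightarrow> complex mat \<Rightarrow> bool" where
  "primary_value f A B \<longleftrightarrow>
     (\<exists>n_as Q Q'. 0 \<notin> fst ` set n_as \<and> similar_mat_wit A (jordan_matrix n_as) Q Q'
        \<and> snd ` set n_as \<subseteq> dom f \<and> B = Q * stem_jordan_matrix f n_as * Q')"

definition primary_matrix_function ::
  "complex set \<Rightarrow> nat \<Rightarrow> stem_function \<Rightarrow> (complex mat \<rightharpoonup> complex mat) \<Rightarrow> bool" where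
  "primary_matrix_function K n f \<sigma> \<longleftrightarrow>
     (\<forall>A \<in> mats_over K n n. \<forall>B. \<sigma> A = Some B \<longleftrightarrow> primary_value f A B)"

text \<open>
  The stem function is undefined at \<open>0\<close>, which makes \<open>\<sigma>\<close> undefined exactly on the singular
  matrices.
\<close>

definition generalized_matrix_sign ::
  "complex set \<Rightarrow> nat \<Rightarrow> (complex mat \<rightharpoonup> complex mat) \<Rightarrow> bool" where
  "generalized_matrix_sign K n \<sigma> \<longleftrightarrow>
     (\<exists>f. f 0 = None \<and> primary_matrix_function K n f \<sigma>) \<and>
     (\<forall>A \<in> mats_over K n n. invertible_mat A \<longrightarrow>
        (\<exists>\<Sigma> \<in> mats_over K n n. \<sigma> A = Some \<Sigma>
           \<and> (\<forall>l. eigenvalue (\<Sigma> * A) l \<longrightarrow> \<not> (Im l = 0 \<and> Re l < 0))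
           \<and> \<sigma> (mat_cnj A) = Some (mat_cnj \<Sigma>)
           \<and> (\<forall>l. eigenvalue \<Sigma> l \<longrightarrow> cmod l = 1)))"

definition generalized_polar_decomposition ::
  "complex set \<Rightarrow> scalar_product_kind \<Rightarrow> nat \<Rightarrow> nat \<Rightarrow> complex mat \<Rightarrow> complex mat
     \<Rightarrow> (complex mat \<rightharpoonup> complex mat) \<Rightarrow> complex mat \<Rightarrow> complex mat \<Rightarrow> complex mat \<Rightarrow> bool" where
  "generalized_polar_decomposition K k m n M N \<sigma> F W S \<longleftrightarrow>
     W \<in> mats_over K m n \<and> S \<in> mats_over K n n \<and> F = W * S \<and>
     (\<exists>\<Sigma>. \<sigma> (adj k M N F * F) = Some \<Sigma>
        \<and> r_positive_definite S \<and> selfadjoint_wrt k N S \<and> selfadjoint_wrt k (N * \<Sigma>) S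
        \<and> orthonormal_columns k M (N * mat_inv \<Sigma>) W
        \<and> adj k N M (adj k M N W) = W)"

end

theory Submission
  imports Defs
begin

text \<open>
  Put \<open>A = F\<^sup>[\<^sup>M\<^sup>,\<^sup>N\<^sup>] F\<close>.
  In a decomposition \<open>F = W S\<close> the two selfadjointness conditions say that \<open>S\<close> commutes with
  \<open>\<Sigma>\<close>, and orthonormality of \<open>W\<close> then turns \<open>A\<close> into \<open>S \<Sigma>\<^sup>-\<^sup>1 S\<close>, so that
  \<open>S\<^sup>2 = \<Sigma> A\<close>; hence \<open>S\<close> is the principal square root and \<open>W\<close> is determined by it.
  Conversely, let \<open>S\<close> be the principal square root of \<open>\<Sigma> A\<close>. The double adjoint condition makes
  \<open>A\<close> selfadjoint. Being a primary matrix function, \<open>\<sigma>\<close> is compatible with similarity and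
  transposition, which makes \<open>\<Sigma>\<close> selfadjoint and lets it commute with \<open>A\<close>.
  The uniqueness of the principal square root carries every such symmetry over to \<open>S\<close>:
  commutation with \<open>\<Sigma>\<close>, selfadjointness and realness.
\<close>

section \<open>Inverses, adjoints and eigenvalues\<close>

text \<open>Compatibility of the shapes is stated by dimension equations, which rewriting can
  settle, so long products are reassociated without naming the intermediate dimensions.\<close>

lemma assoc_mult_mat_dim:
  fixes A B C :: "'a :: semiring_0 mat"
  assumes "dim_col A = dim_row B" "dim_col B = dim_row C"
  shows "A * B * C = A * (B * C)"
  using assms by (intro assoc_mult_mat[of _ "dim_row A" "dim_row B" _ "dim_row C" _ "dim_col C"]) auto

lemma mult_inverse_mult_mat:
  fixes A B C :: "'a :: semiring_1 mat"
  assumes "A * B = 1\<^sub>m n" "dim_col A = dim_row B" "dim_col B = dim_row C" "dim_row C = n"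
  shows "A * (B * C) = C"
  using assms by (simp flip: assoc_mult_mat_dim)

text \<open>For square matrices over a field, a right inverse is also a left inverse.\<close>

lemma invertible_matI:
  assumes "A \<in> carrier_mat n n" "B \<in> carrier_mat n n" "A * B = 1\<^sub>m n"
  shows "invertible_mat (A :: complex mat)"
  using assms mat_mult_left_right_inverse[OF assms]
  unfolding invertible_mat_def inverts_mat_def by auto

lemma mat_inv:
  assumes A: "A \<in> carrier_mat n n" and "invertible_mat A"
  shows "mat_inv A \<in> carrier_mat n n" "A * mat_inv A = 1\<^sub>m n" "mat_inv A * A = 1\<^sub>m n"
proof -
  obtain B where B: "A * B = 1\<^sub>m n" "B * A = 1\<^sub>m (dim_row B)"
    using assms unfolding invertible_mat_def inverts_mat_def by auto
  \<comment> \<open>\<open>inverts_mat\<close> does not prescribe the shape of \<open>B\<close>;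
    both dimensions are read off from the two products with \<open>A\<close>.\<close>
  have [simp]: "dim_col B = n" using arg_cong[OF B(1), of dim_col] by simp
  have [simp]: "dim_row B = n" using arg_cong[OF B(2), of dim_col] A by simp
  have "B \<in> carrier_mat n n" by auto
  hence "A \<in> Units (ring_mat TYPE(complex) n ())"
    using A B unfolding Units_def ring_mat_def by auto
  then obtain C where C: "mat_inverse A = Some C"
    using mat_inverse(1)[OF A, of "()"] by (cases "mat_inverse A") auto
  show "mat_inv A \<in> carrier_mat n n" "A * mat_inv A = 1\<^sub>m n" "mat_inv A * A = 1\<^sub>m n"
    using mat_inverse(2)[OF A C] C unfolding mat_inv_def by auto
qed

lemma mat_inv_eqI:
  assumes A: "A \<in> carrier_mat n n" and B: "B \<in> carrier_mat n n" and AB: "A * B = 1\<^sub>m n"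
  shows "mat_inv A = B"
proof -
  note inv = mat_inv[OF A invertible_matI[OF A B AB]]
  have "mat_inv A = mat_inv A * (A * B)" using AB inv by simp
  also have "\<dots> = mat_inv A * A * B" using A B inv(1) by simp
  also have "\<dots> = B" using inv(3) B by simp
  finally show ?thesis .
qed

lemma invertible_mat_mult:
  assumes A: "A \<in> carrier_mat n n" "invertible_mat A"
    and B: "B \<in> carrier_mat n n" "invertible_mat B"
  shows "invertible_mat (A * B)" "mat_inv (A * B) = mat_inv B * mat_inv A"
proof -
  note a = mat_inv[OF A] and b = mat_inv[OF B]
  have "A * B * (mat_inv B * mat_inv A) = A * (B * mat_inv B) * mat_inv A"
    using A B a(1) b(1) by (simp add: assoc_mult_mat_dim)
  also have "\<dots> = 1\<^sub>m n" using A a b by simp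
  finally have *: "A * B * (mat_inv B * mat_inv A) = 1\<^sub>m n" .
  show "invertible_mat (A * B)" "mat_inv (A * B) = mat_inv B * mat_inv A"
    using invertible_matI[OF _ _ *] mat_inv_eqI[OF _ _ *] A(1) B(1) a(1) b(1) by auto
qed

lemma invertible_mat_inv:
  assumes "A \<in> carrier_mat n n" "invertible_mat A"
  shows "invertible_mat (mat_inv A)" "mat_inv (mat_inv A) = A"
  using invertible_matI mat_inv_eqI mat_inv[OF assms] assms(1) by blast+

lemma mult_mat_left_cancel:
  fixes A B C :: "complex mat"
  assumes A: "A \<in> carrier_mat n n" "invertible_mat A"
    and B: "B \<in> carrier_mat n l" and C: "C \<in> carrier_mat n l"
  shows "A * B = A * C \<longleftrightarrow> B = C"
proof
  assume "A * B = A * C"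
  hence "mat_inv A * A * B = mat_inv A * A * C"
    using A B C mat_inv(1)[OF A] by (simp add: assoc_mult_mat_dim)
  thus "B = C" using mat_inv(3)[OF A] B C by simp
qed simp

lemma mult_mat_right_cancel:
  fixes A B C :: "complex mat"
  assumes A: "A \<in> carrier_mat n n" "invertible_mat A"
    and B: "B \<in> carrier_mat l n" and C: "C \<in> carrier_mat l n"
  shows "B * A = C * A \<longleftrightarrow> B = C"
proof
  assume "B * A = C * A"
  hence "B * (A * mat_inv A) = C * (A * mat_inv A)"
    using A B C mat_inv(1)[OF A] by (simp flip: assoc_mult_mat_dim del: assoc_mult_mat)
  thus "B = C" using mat_inv(2)[OF A] B C by simp
qed simp

lemma invertible_mat_iff_det:
  assumes A: "(A :: complex mat) \<in> carrier_mat n n"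
  shows "invertible_mat A \<longleftrightarrow> det A \<noteq> 0"
proof
  assume "invertible_mat A"
  from mat_inv[OF A this] have "det A * det (mat_inv A) = 1"
    using A by (metis det_mult det_one)
  thus "det A \<noteq> 0" by auto
next
  assume "det A \<noteq> 0"
  from det_non_zero_imp_unit[OF A this, of "()"]
  show "invertible_mat A"
    unfolding Units_def ring_mat_def using invertible_matI[OF A] by auto
qed

lemma invertible_mat_iff_eigenvalue:
  assumes A: "(A :: complex mat) \<in> carrier_mat n n"
  shows "invertible_mat A \<longleftrightarrow> \<not> eigenvalue A 0"
proof -
  have "char_matrix A 0 = A" using A unfolding char_matrix_def by auto
  thus ?thesis using invertible_mat_iff_det[OF A] eigenvalue_det[OF A, of 0] by simp
qed

lemma eigenvalue_similar:
  assumes "similar_mat A (B :: complex mat)"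
  shows "eigenvalue A l \<longleftrightarrow> eigenvalue B l"
proof -
  obtain n where "A \<in> carrier_mat n n" "B \<in> carrier_mat n n" using similar_matD[OF assms] by auto
  thus ?thesis using char_poly_similar[OF assms] by (simp add: eigenvalue_root_char_poly)
qed

lemma eigenvalue_upper_triangular:
  assumes A: "(A :: complex mat) \<in> carrier_mat n n" and "upper_triangular A"
  shows "eigenvalue A l \<longleftrightarrow> (\<exists>i<n. A $$ (i, i) = l)"
proof -
  have "poly (char_poly A) l = (\<Prod>a\<leftarrow>diag_mat A. l - a)"
    unfolding char_poly_upper_triangular[OF assms] poly_prod_list by (simp add: o_def)
  also have "\<dots> = 0 \<longleftrightarrow> l \<in> set (diag_mat A)"
    by (simp add: prod_list_zero_iff image_iff)
  finally show ?thesis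
    using A unfolding eigenvalue_root_char_poly[OF A] by (auto simp: diag_mat_def)
qed

section \<open>Entrywise conjugation and the operation \<open>sharp\<close>\<close>

lemma mat_cnj_mult:
  assumes "dim_col A = dim_row B"
  shows "mat_cnj (A * B) = mat_cnj A * mat_cnj B"
  using assms by (intro eq_matI) (auto simp: scalar_prod_def)

lemma mat_cnj_cnj [simp]: "mat_cnj (mat_cnj A) = A"
  by (intro eq_matI) auto

lemma mat_adjoint_eq: "mat_adjoint A = mat_cnj (transpose_mat (A :: complex mat))"
  unfolding mat_adjoint_def by (intro eq_matI) (auto simp: mat_of_rows_def)

lemma sharp_dim [simp]: "dim_row (sharp k A) = dim_col A" "dim_col (sharp k A) = dim_row A"
  by (cases k; simp add: mat_adjoint_eq)+

lemma sharp_carrier [simp]: "A \<in> carrier_mat m n \<Longrightarrow> sharp k A \<in> carrier_mat n m"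
  by (metis carrier_matD carrier_matI sharp_dim)

lemma sharp_sharp [simp]: "sharp k (sharp k A) = A"
  by (cases k) (auto simp: mat_adjoint_eq intro!: eq_matI)

lemma sharp_mult:
  assumes "dim_col A = dim_row B"
  shows "sharp k (A * B) = sharp k B * sharp k A"
proof -
  have "transpose_mat (A * B) = transpose_mat B * transpose_mat A"
    using assms by (intro transpose_mult[of _ "dim_row A" "dim_col A" _ "dim_col B"]) auto
  thus ?thesis using assms by (cases k) (auto simp: mat_adjoint_eq mat_cnj_mult)
qed

lemma sharp_one [simp]: "sharp k (1\<^sub>m n) = 1\<^sub>m n"
  by (cases k) (auto simp: mat_adjoint_eq intro!: eq_matI)

lemma sharp_invertible:
  assumes "A \<in> carrier_mat n n" "invertible_mat A"
  shows "invertible_mat (sharp k A)" "mat_inv (sharp k A) = sharp k (mat_inv A)"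
proof -
  note a = mat_inv[OF assms]
  have "sharp k A * sharp k (mat_inv A) = sharp k (mat_inv A * A)"
    using a(1) assms by (simp add: sharp_mult)
  hence *: "sharp k A * sharp k (mat_inv A) = 1\<^sub>m n" using a by simp
  show "invertible_mat (sharp k A)" "mat_inv (sharp k A) = sharp k (mat_inv A)"
    using invertible_matI[OF _ _ *] mat_inv_eqI[OF _ _ *] assms(1) a(1) by auto
qed

lemma eigenvalue_mat_cnj:
  assumes A: "A \<in> carrier_mat n n" and "eigenvalue (mat_cnj A) l"
  shows "eigenvalue A (cnj l)"
proof -
  interpret cnj: inj_comm_ring_hom cnj by unfold_locales auto
  have "mat_cnj A \<in> carrier_mat n n" using A by simp
  from cnj.eigenvalue_hom[OF this assms(2)] show ?thesis by simp
qed

text \<open>Transposition keeps the spectrum and the conjugate transpose conjugates it. The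
  disjunction covers both kinds of scalar product, and both alternatives give the same real part,
  which is what r-positive-definiteness tests.\<close>

lemma eigenvalue_sharp:
  assumes A: "A \<in> carrier_mat n n" and "eigenvalue (sharp k A) l"
  shows "eigenvalue A l \<or> eigenvalue A (cnj l)"
proof -
  have At: "transpose_mat A \<in> carrier_mat n n" using A by simp
  have "eigenvalue (transpose_mat A) x \<longleftrightarrow> eigenvalue A x" for x
    using A At by (simp add: eigenvalue_root_char_poly)
  thus ?thesis using assms(2) eigenvalue_mat_cnj[OF At]
    by (cases k) (auto simp: mat_adjoint_eq)
qed

lemma r_positive_definite_sharp:
  assumes "A \<in> carrier_mat n n" "r_positive_definite A"
  shows "r_positive_definite (sharp k A)"
  using eigenvalue_sharp[OF assms(1)] assms(2) unfolding r_positive_definite_def by fastforce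

lemma r_positive_definite_invertible:
  assumes "A \<in> carrier_mat n n" "r_positive_definite A"
  shows "invertible_mat A"
  using assms unfolding r_positive_definite_def by (auto simp: invertible_mat_iff_eigenvalue)

section \<open>Principal square roots\<close>

lemma schur_triangularization:
  assumes "(A :: complex mat) \<in> carrier_mat n n"
  obtains T P Q where "T \<in> carrier_mat n n" "upper_triangular T" "similar_mat_wit A T P Q"
proof -
  obtain es where "char_poly A = (\<Prod>a\<leftarrow>es. [:- a, 1:])"
    using char_poly_factorized[OF assms] by blast
  from schur_decomposition_exists[OF assms this] obtain T
    where "T \<in> carrier_mat n n" "upper_triangular T" "similar_mat A T" by blast
  thus thesis using that unfolding similar_mat_def by blast
qed

text \<open>Induction over the columns of \<open>Z\<close>. Once the columns before \<open>j\<close>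
  vanish, triangularity of \<open>T\<close> reduces column \<open>j\<close> of
  \<open>X * Z = Z * T\<close> to an eigenvector equation for \<open>X\<close> with the diagonal
  entry of \<open>T\<close> as eigenvalue; that entry is no eigenvalue of \<open>X\<close>, so the
  column is zero.\<close>

lemma sylvester_triangular_unique:
  assumes X: "(X :: complex mat) \<in> carrier_mat n n" and T: "T \<in> carrier_mat l l"
    and Z: "Z \<in> carrier_mat n l" and ut: "upper_triangular T"
    and XZ: "X * Z = Z * T"
    and disj: "\<And>i. i < l \<Longrightarrow> \<not> eigenvalue X (T $$ (i, i))"
  shows "Z = 0\<^sub>m n l"
proof -
  have "j < l \<longrightarrow> col Z j = 0\<^sub>v n" for j
  proof (induction j rule: less_induct)
    case (less j)
    show ?case
    proof
      assume j: "j < l"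
      have "X *\<^sub>v col Z j = T $$ (j, j) \<cdot>\<^sub>v col Z j"
      proof (rule eq_vecI)
        fix r assume "r < dim_vec (T $$ (j, j) \<cdot>\<^sub>v col Z j)"
        hence r: "r < n" using Z by simp
        have zero: "Z $$ (r, i) * T $$ (i, j) = 0" if "i < l" "i \<noteq> j" for i
        proof (cases "i < j")
          case True
          hence "col Z i = 0\<^sub>v n" using less.IH that by blast
          hence "Z $$ (r, i) = 0" using r Z that by (metis carrier_matD index_col index_zero_vec(1))
          thus ?thesis by simp
        next
          case False
          hence "T $$ (i, j) = 0" using ut T that by auto
          thus ?thesis by simp
        qed
        have "(X *\<^sub>v col Z j) $ r = (X * Z) $$ (r, j)" using X Z r j by simp
        also have "\<dots> = (\<Sum>i = 0..<l. Z $$ (r, i) * T $$ (i, j))"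
          unfolding XZ using Z T r j by (simp add: scalar_prod_def)
        also have "\<dots> = (\<Sum>i\<in>{j}. Z $$ (r, i) * T $$ (i, j))"
          using j zero by (intro sum.mono_neutral_right) auto
        finally show "(X *\<^sub>v col Z j) $ r = (T $$ (j, j) \<cdot>\<^sub>v col Z j) $ r"
          using Z r j by simp
      qed (use X Z in simp)
      moreover have "col Z j \<in> carrier_vec n" using Z by auto
      ultimately show "col Z j = 0\<^sub>v n"
        using disj[OF j] X unfolding eigenvalue_def eigenvector_def by auto
    qed
  qed
  thus ?thesis using Z by (intro mat_col_eqI) auto
qed

text \<open>If \<open>X * X = Y * Y\<close>, then \<open>Z = X - Y\<close> solves the Sylvester equation \<open>X * Z = - (Z * Y)\<close>.\<close>

lemma rhp_sqrt_unique:
  assumes "rhp_sqrt A X" "rhp_sqrt A Y"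
  shows "X = Y"
proof -
  define n where "n = dim_row A"
  have X: "X \<in> carrier_mat n n" and Y: "Y \<in> carrier_mat n n" and sq: "X * X = Y * Y"
    and posX: "\<And>l. eigenvalue X l \<Longrightarrow> Re l > 0" and posY: "\<And>l. eigenvalue Y l \<Longrightarrow> Re l > 0"
    using assms unfolding rhp_sqrt_def n_def by auto
  obtain T P Q where T: "T \<in> carrier_mat n n" and ut: "upper_triangular T"
    and sim: "similar_mat_wit Y T P Q"
    using schur_triangularization[OF Y] .
  note wit = similar_mat_witD2[OF Y sim]
  \<comment> \<open>The factor \<open>P\<close> replaces \<open>Y\<close> by its triangular form, so
    that the Sylvester equation reads \<open>X * Z = Z * (-T)\<close>.\<close>
  define Z where "Z = (X - Y) * P"
  have Z: "Z \<in> carrier_mat n n" unfolding Z_def using X Y wit by auto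
  have "Y * P = P * (T * (Q * P))" using wit by (simp add: assoc_mult_mat_dim)
  hence YP: "Y * P = P * T" using wit by simp
  have "Z * (-T) = - ((X - Y) * (P * T))"
    unfolding Z_def using X Y wit T by (simp add: assoc_mult_mat_dim)
  also have "\<dots> = - ((X - Y) * Y * P)"
    unfolding YP[symmetric] using X Y wit T by (simp add: assoc_mult_mat_dim)
  also have "\<dots> = - ((X - Y) * Y) * P" using X Y wit by simp
  also have "- ((X - Y) * Y) = X * (X - Y)"
    using X Y sq by (simp add: mult_minus_distrib_mat minus_mult_distrib_mat)
      (auto intro!: eq_matI simp del: index_mult_mat(1))
  also have "X * (X - Y) * P = X * Z" unfolding Z_def using X Y wit by (simp add: assoc_mult_mat_dim)
  finally have "X * Z = Z * (-T)" ..
  moreover have "upper_triangular (-T)" using ut T unfolding upper_triangular_def by auto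
  \<comment> \<open>The diagonal of \<open>-T\<close> consists of negated eigenvalues of
    \<open>Y\<close> and lies in the open left half-plane, while the spectrum of \<open>X\<close>
    lies in the right one.\<close>
  moreover have "\<not> eigenvalue X ((-T) $$ (i, i))" if "i < n" for i
  proof
    assume "eigenvalue X ((-T) $$ (i, i))"
    hence "Re (T $$ (i, i)) < 0" using posX T that by fastforce
    moreover have "eigenvalue Y (T $$ (i, i))"
      using eigenvalue_similar[of Y T] sim eigenvalue_upper_triangular[OF T ut] that
      unfolding similar_mat_def by blast
    ultimately show False using posY by fastforce
  qed
  ultimately have "Z = 0\<^sub>m n n"
    using X Z T by (intro sylvester_triangular_unique[of X n "-T"]) auto
  hence "(X - Y) * P = 0\<^sub>m n n * P" using wit unfolding Z_def by simp
  hence *: "X - Y = 0\<^sub>m n n"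
    using X Y wit(6) invertible_matI[OF wit(6,7,1)] mult_mat_right_cancel by (metis minus_carrier_mat zero_carrier_mat)
  show ?thesis
  proof (rule eq_matI)
    fix i j assume "i < dim_row Y" "j < dim_col Y"
    thus "X $$ (i, j) = Y $$ (i, j)" using arg_cong[OF *, of "\<lambda>A. A $$ (i, j)"] X Y by auto
  qed (use X Y in auto)
qed

text \<open>Induction on the size, splitting off the first row and column. The corner entry gets its
  scalar root \<open>s\<close>, the lower block gets a root \<open>V\<close> by induction, and the
  remaining row \<open>v\<close> has to solve the linear equation
  \<open>s v + v V = r\<close>.\<close>

lemma upper_triangular_sqrt:
  assumes "(T :: complex mat) \<in> carrier_mat n n" "upper_triangular T"
    and "\<And>i. i < n \<Longrightarrow> \<not> (Im (T $$ (i, i)) = 0 \<and> Re (T $$ (i, i)) \<le> 0)"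
  shows "\<exists>U \<in> carrier_mat n n. upper_triangular U \<and> U * U = T \<and> (\<forall>i<n. Re (U $$ (i, i)) > 0)"
  using assms
proof (induction n arbitrary: T)
  case 0
  thus ?case by (intro bexI[of _ T]) auto
next
  case (Suc n)
  obtain a r c D where split: "split_block T 1 1 = (a, r, c, D)" by (metis prod_cases4)
  from split_block[OF split, of n n] Suc.prems(1)
  have a: "a \<in> carrier_mat 1 1" and r: "r \<in> carrier_mat 1 n" and c: "c \<in> carrier_mat n 1"
    and D: "D \<in> carrier_mat n n" and T: "T = four_block_mat a r c D" by auto
  have c0: "c = 0\<^sub>m n 1"
  proof (rule eq_matI)
    fix i j assume ij: "i < dim_row (0\<^sub>m n 1 :: complex mat)" "j < dim_col (0\<^sub>m n 1 :: complex mat)"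
    hence "T $$ (Suc i, 0) = 0" using Suc.prems(1,2) by auto
    thus "c $$ (i, j) = 0\<^sub>m n 1 $$ (i, j)" using ij a c D unfolding T by simp
  qed (use c in auto)
  have D_T: "D $$ (i, j) = T $$ (Suc i, Suc j)" if "i < n" "j < n" for i j
    using that a D unfolding T by simp
  have "upper_triangular D"
    using Suc.prems(1,2) D D_T unfolding upper_triangular_def by auto
  moreover have "\<not> (Im (D $$ (i, i)) = 0 \<and> Re (D $$ (i, i)) \<le> 0)" if "i < n" for i
    using Suc.prems(3)[of "Suc i"] that D_T by simp
  ultimately obtain V where V: "V \<in> carrier_mat n n" "upper_triangular V" "V * V = D"
    and posV: "\<And>i. i < n \<Longrightarrow> Re (V $$ (i, i)) > 0"
    using Suc.IH[OF D] by blast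
  define s where "s = csqrt (a $$ (0, 0))"
  have "T $$ (0, 0) = a $$ (0, 0)" using a D unfolding T by simp
  hence na: "\<not> (Im (a $$ (0, 0)) = 0 \<and> Re (a $$ (0, 0)) \<le> 0)" using Suc.prems(3)[of 0] by simp
  have s: "s * s = a $$ (0, 0)" unfolding s_def by (metis power2_csqrt power2_eq_square)
  \<comment> \<open>The square of an imaginary number is a nonpositive real, which the hypothesis on
    the diagonal excludes; \<open>csqrt\<close> itself only guarantees a nonnegative real
    part.\<close>
  have "Re s \<noteq> 0"
  proof
    assume "Re s = 0"
    with s na show False
      by (metis Im_complex_of_real Re_complex_of_real complex_eq_0 mult_zero_left complex.sel add.right_neutral diff_0 minus_complex.sel times_complex.sel mult_zero_right neg_le_0_iff_le zero_le_square)
  qed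
  hence pos: "Re s > 0" using csqrt_principal[of "a $$ (0, 0)"] unfolding s_def by auto
  \<comment> \<open>The equation for the row \<open>v\<close> is \<open>v * E = r\<close>.
    \<open>E\<close> is triangular, and its diagonal entries are sums of two numbers with positive
    real part, so it can be inverted.\<close>
  define E where "E = s \<cdot>\<^sub>m 1\<^sub>m n + V"
  have E: "E \<in> carrier_mat n n" unfolding E_def using V by simp
  have "upper_triangular E" using V unfolding E_def upper_triangular_def by auto
  hence "\<not> eigenvalue E 0"
    using posV pos V unfolding eigenvalue_upper_triangular[OF E \<open>upper_triangular E\<close>]
    by (auto simp: E_def complex_eq_iff) (metis add_pos_pos less_irrefl)
  hence "invertible_mat E" using invertible_mat_iff_eigenvalue[OF E] by blast
  note inv = mat_inv[OF E this]
  define v where "v = r * mat_inv E"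
  have v: "v \<in> carrier_mat 1 n" unfolding v_def using r inv by simp
  have "v * E = r * (mat_inv E * E)" unfolding v_def using r E inv(1) by (simp add: assoc_mult_mat_dim)
  hence "v * E = r" using inv r by simp
  moreover have "v * E = s \<cdot>\<^sub>m v + v * V"
    unfolding E_def using v V mult_smult_distrib[OF v one_carrier_mat, of s]
    by (simp add: mult_add_distrib_mat[of v 1 n _ n])
  ultimately have vr: "s \<cdot>\<^sub>m v + v * V = r" by simp
  define S1 where "S1 = s \<cdot>\<^sub>m (1\<^sub>m 1 :: complex mat)"
  have S1: "S1 \<in> carrier_mat 1 1" unfolding S1_def by simp
  have "S1 * S1 = a" using a s unfolding S1_def by (auto intro!: eq_matI simp: scalar_prod_def)
  moreover have "S1 * v = s \<cdot>\<^sub>m v"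
    unfolding S1_def using v mult_smult_assoc_mat[OF one_carrier_mat v, of s] by simp
  ultimately have "four_block_mat S1 v (0\<^sub>m n 1) V * four_block_mat S1 v (0\<^sub>m n 1) V = T"
    unfolding T c0 using S1 v V vr a D
    by (subst mult_four_block_mat[of _ 1 1 _ n _ n _ _ 1 _ n]) (auto simp: right_add_zero_mat[of _ 1 1])
  moreover have "upper_triangular (four_block_mat S1 v (0\<^sub>m n 1) V)"
    using S1 v V unfolding upper_triangular_def by auto
  moreover have "\<forall>i<Suc n. Re (four_block_mat S1 v (0\<^sub>m n 1) V $$ (i, i)) > 0"
    using S1 v V posV pos by (auto simp: S1_def)
  moreover have "four_block_mat S1 v (0\<^sub>m n 1) V \<in> carrier_mat (Suc n) (Suc n)"
    using four_block_carrier_mat[OF S1 V(1)] by simp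
  ultimately show ?case by blast
qed

text \<open>The root is taken on a Schur form, whose diagonal consists of eigenvalues of
  \<open>A\<close>, and is conjugated back; similarity preserves the spectrum of the root.\<close>

lemma rhp_sqrt_exists:
  assumes A: "A \<in> carrier_mat n n" and nonneg: "no_eigenvalue_nonpos_real A"
  shows "\<exists>X. rhp_sqrt A X"
proof -
  obtain T P Q where T: "T \<in> carrier_mat n n" and ut: "upper_triangular T"
    and sim: "similar_mat_wit A T P Q"
    using schur_triangularization[OF A] .
  note wit = similar_mat_witD2[OF A sim]
  have "eigenvalue A (T $$ (i, i))" if "i < n" for i
    using eigenvalue_similar[of A T] sim eigenvalue_upper_triangular[OF T ut] that
    unfolding similar_mat_def by blast
  then obtain U where U: "U \<in> carrier_mat n n" "upper_triangular U" "U * U = T"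
    and pos: "\<And>i. i < n \<Longrightarrow> Re (U $$ (i, i)) > 0"
    using upper_triangular_sqrt[OF T ut] nonneg unfolding no_eigenvalue_nonpos_real_def by blast
  have "Q * (P * (U * Q)) = U * Q" using wit(2,4-) U(1) by (intro mult_inverse_mult_mat[of Q P n]) auto
  hence "P * U * Q * (P * U * Q) = P * (U * U) * Q"
    using wit(4-) U(1) by (simp add: assoc_mult_mat_dim)
  hence "P * U * Q * (P * U * Q) = A" using wit U by simp
  moreover have "similar_mat (P * U * Q) U"
    using wit U by (intro similar_matI[of _ _ P Q n]) auto
  hence "Re l > 0" if "eigenvalue (P * U * Q) l" for l

    using that pos eigenvalue_similar[of "P * U * Q" U l] eigenvalue_upper_triangular[OF U(1,2)] by auto
  moreover have "P * U * Q \<in> carrier_mat (dim_row A) (dim_row A)" using wit U by auto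
  ultimately show ?thesis unfolding rhp_sqrt_def by blast
qed

section \<open>Primary matrix functions\<close>

text \<open>The reversal permutation matrix, with ones on the antidiagonal; indices start at 0, so
  this is where \<open>i + j = s - 1\<close>.\<close>

definition exchange_mat :: "nat \<Rightarrow> complex mat" where
  "exchange_mat s = mat s s (\<lambda>(i, j). if Suc (i + j) = s then 1 else 0)"

text \<open>Symmetry about the antidiagonal. Every square Toeplitz matrix has it, in particular a
  Jordan block and its image under a stem function.\<close>

definition persymmetric_mat :: "complex mat \<Rightarrow> bool" where
  "persymmetric_mat A \<longleftrightarrow> square_mat A \<and>
     (\<forall>i<dim_row A. \<forall>j<dim_row A. A $$ (i, j) = A $$ (dim_row A - Suc j, dim_row A - Suc i))"

lemma exchange_mat_carrier [simp]: "exchange_mat s \<in> carrier_mat s s"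
  unfolding exchange_mat_def by simp

lemma exchange_mat_dim [simp]: "dim_row (exchange_mat s) = s" "dim_col (exchange_mat s) = s"
  unfolding exchange_mat_def by simp_all

lemma exchange_mat_mult:
  assumes "dim_row A = s" "i < s" "j < dim_col A"
  shows "(exchange_mat s * A) $$ (i, j) = A $$ (s - Suc i, j)"
proof -
  have "(exchange_mat s * A) $$ (i, j) = (\<Sum>l = 0..<s. exchange_mat s $$ (i, l) * A $$ (l, j))"
    using assms by (simp add: scalar_prod_def)
  also have "\<dots> = (\<Sum>l\<in>{s - Suc i}. exchange_mat s $$ (i, l) * A $$ (l, j))"
    using assms by (intro sum.mono_neutral_right) (auto simp: exchange_mat_def)
  finally show ?thesis using assms by (simp add: exchange_mat_def)
qed

lemma mult_exchange_mat:
  assumes "dim_col A = s" "i < dim_row A" "j < s"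
  shows "(A * exchange_mat s) $$ (i, j) = A $$ (i, s - Suc j)"
proof -
  have "(A * exchange_mat s) $$ (i, j) = (\<Sum>l = 0..<s. A $$ (i, l) * exchange_mat s $$ (l, j))"
    using assms by (simp add: scalar_prod_def)
  also have "\<dots> = (\<Sum>l\<in>{s - Suc j}. A $$ (i, l) * exchange_mat s $$ (l, j))"
    using assms by (intro sum.mono_neutral_right) (auto simp: exchange_mat_def)
  finally show ?thesis using assms by (simp add: exchange_mat_def)
qed

lemma exchange_mat_involutive: "exchange_mat s * exchange_mat s = 1\<^sub>m s"
proof (rule eq_matI)
  fix i j assume "i < dim_row (1\<^sub>m s :: complex mat)" "j < dim_col (1\<^sub>m s :: complex mat)"
  thus "(exchange_mat s * exchange_mat s) $$ (i, j) = 1\<^sub>m s $$ (i, j)"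
    by (simp add: exchange_mat_mult del: index_mult_mat(1)) (auto simp: exchange_mat_def)
qed auto

lemma persymmetric_square: "persymmetric_mat A \<Longrightarrow> dim_col A = dim_row A"
  unfolding persymmetric_mat_def square_mat.simps by blast

text \<open>Conjugation by the exchange matrix reverses both the row and the column order, and by
  persymmetry this double reversal is transposition.\<close>

lemma persymmetric_similar_transpose:
  assumes "persymmetric_mat A"
  shows "similar_mat_wit (transpose_mat A) A (exchange_mat (dim_row A)) (exchange_mat (dim_row A))"
proof -
  define s where "s = dim_row A"
  have A: "dim_row A = s" "dim_col A = s"
    using persymmetric_square[OF assms] s_def by auto
  have sym: "A $$ (i, j) = A $$ (s - Suc j, s - Suc i)" if "i < s" "j < s" for i j
    using assms that unfolding persymmetric_mat_def s_def by blast
  have "transpose_mat A = exchange_mat s * A * exchange_mat s"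
  proof (rule eq_matI)
    fix i j assume "i < dim_row (exchange_mat s * A * exchange_mat s)"
      "j < dim_col (exchange_mat s * A * exchange_mat s)"
    hence ij: "i < s" "j < s" by auto
    have "(exchange_mat s * A * exchange_mat s) $$ (i, j) = (exchange_mat s * A) $$ (i, s - Suc j)"
      using ij A by (intro mult_exchange_mat) auto
    also have "\<dots> = A $$ (s - Suc i, s - Suc j)" using ij A by (intro exchange_mat_mult) auto
    also have "\<dots> = A $$ (j, i)" using sym[of j i] ij by simp
    finally show "transpose_mat A $$ (i, j) = (exchange_mat s * A * exchange_mat s) $$ (i, j)"
      using ij A by simp
  qed (use A in auto)
  thus ?thesis unfolding s_def[symmetric] using A exchange_mat_involutive
    by (intro similar_mat_witI[where n = s]) auto
qed

text \<open>Block by block application of the previous fact. \<open>R\<close> is given explicitly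
  because it depends only on the sizes of the blocks, so that one \<open>R\<close> serves different
  block lists of the same shape.\<close>

lemma diag_block_persymmetric_similar_transpose:
  assumes "\<forall>A\<in>set As. persymmetric_mat A"
  defines "R \<equiv> diag_block_mat (map (\<lambda>A. exchange_mat (dim_row A)) As)"
  shows "similar_mat_wit (transpose_mat (diag_block_mat As)) (diag_block_mat As) R R"
  using assms(1) unfolding R_def
proof (induction As)
  case Nil
  thus ?case by (auto intro!: similar_mat_witI[where n = 0])
next
  case (Cons A As)
  let ?R = "diag_block_mat (map (\<lambda>A. exchange_mat (dim_row A)) As)"
  define s D d where "s = dim_row A" and "D = diag_block_mat As" and "d = dim_row D"
  have A: "A \<in> carrier_mat s s"
    using Cons.prems persymmetric_square[of A] unfolding s_def by auto
  have "square_mat D"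
    unfolding D_def using Cons.prems by (intro diag_block_mat_square) (auto simp: persymmetric_square)
  hence D: "D \<in> carrier_mat d d" unfolding d_def by auto
  have R: "?R \<in> carrier_mat d d"
    unfolding d_def D_def by (rule carrier_matI) (simp_all add: dim_diag_block_mat o_def)
  have "similar_mat_wit (transpose_mat A) A (exchange_mat s) (exchange_mat s)"
    unfolding s_def using Cons.prems by (intro persymmetric_similar_transpose) simp
  moreover have "similar_mat_wit (transpose_mat D) D ?R ?R"
    unfolding D_def using Cons.prems by (intro Cons.IH) simp
  ultimately have "similar_mat_wit
      (four_block_mat (transpose_mat A) (0\<^sub>m s d) (0\<^sub>m d s) (transpose_mat D))
      (four_block_mat A (0\<^sub>m s d) (0\<^sub>m d s) D)
      (four_block_mat (exchange_mat s) (0\<^sub>m s d) (0\<^sub>m d s) ?R)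
      (four_block_mat (exchange_mat s) (0\<^sub>m s d) (0\<^sub>m d s) ?R)"
    by (rule similar_mat_wit_four_block) (use A D R in auto)
  moreover have "diag_block_mat (A # As) = four_block_mat A (0\<^sub>m s d) (0\<^sub>m d s) D"
    using A D by (simp add: Let_def flip: D_def)
  moreover have "transpose_mat (four_block_mat A (0\<^sub>m s d) (0\<^sub>m d s) D) =
      four_block_mat (transpose_mat A) (0\<^sub>m s d) (0\<^sub>m d s) (transpose_mat D)"
    by (simp add: transpose_four_block_mat[OF A _ _ D])
  moreover have "diag_block_mat (map (\<lambda>A. exchange_mat (dim_row A)) (A # As)) =
      four_block_mat (exchange_mat s) (0\<^sub>m s d) (0\<^sub>m d s) ?R"
    using R by (simp add: Let_def flip: s_def)
  ultimately show ?case by (simp only:)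
qed

section \<open>Values of a stem function: similarity, transposition and domain\<close>

lemma stem_jordan_matrix_carrier:
  "stem_jordan_matrix f n_as \<in> carrier_mat (sum_list (map fst n_as)) (sum_list (map fst n_as))"
  unfolding stem_jordan_matrix_def
  by (rule carrier_matI) (auto simp: dim_diag_block_mat stem_block_def o_def case_prod_unfold)

lemma persymmetric_jordan_block: "persymmetric_mat (jordan_block s l)"
  unfolding persymmetric_mat_def by auto

lemma persymmetric_stem_block: "persymmetric_mat (stem_block f s l)"
  unfolding persymmetric_mat_def stem_block_def by auto

text \<open>A Jordan matrix and its image under \<open>f\<close> have blocks of equal sizes, so the
  same \<open>R\<close> transposes both. Sharing \<open>R\<close> is what carries the pair
  \<open>J\<close>, \<open>f(J)\<close> over to the transposes.\<close>

lemma jordan_stem_jordan_similar_transpose: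
  obtains R where
    "similar_mat_wit (transpose_mat (jordan_matrix n_as)) (jordan_matrix n_as) R R"
    "similar_mat_wit (transpose_mat (stem_jordan_matrix f n_as)) (stem_jordan_matrix f n_as) R R"
proof -
  let ?J = "map (\<lambda>(s, l). jordan_block s l) n_as" and ?F = "map (\<lambda>(s, l). stem_block f s l) n_as"
  have "\<forall>A\<in>set ?J. persymmetric_mat A"
    using persymmetric_jordan_block by auto
  moreover have "\<forall>A\<in>set ?F. persymmetric_mat A"
    using persymmetric_stem_block by auto
  moreover have "map (\<lambda>A. exchange_mat (dim_row A)) ?F = map (\<lambda>A. exchange_mat (dim_row A)) ?J"
    by (auto simp: stem_block_def)
  ultimately show thesis
    using that[of "diag_block_mat (map (\<lambda>A. exchange_mat (dim_row A)) ?J)"]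
      diag_block_persymmetric_similar_transpose[of ?J]
      diag_block_persymmetric_similar_transpose[of ?F]
    unfolding jordan_matrix_def stem_jordan_matrix_def by (simp only:)
qed

text \<open>Conjugating a Jordan decomposition of \<open>A\<close> gives one of \<open>A'\<close>
  with the same Jordan matrix, and the value of \<open>f\<close> is conjugated along with
  it.\<close>

lemma primary_value_similar:
  assumes "primary_value f A B" and wit: "similar_mat_wit A' A P P'"
  shows "primary_value f A' (P * B * P')"
proof -
  from assms(1) obtain n_as Q Q' where
    sim: "0 \<notin> fst ` set n_as" "similar_mat_wit A (jordan_matrix n_as) Q Q'" "snd ` set n_as \<subseteq> dom f"
    and B: "B = Q * stem_jordan_matrix f n_as * Q'"
    unfolding primary_value_def by blast
  define n where "n = dim_row A'"
  note w1 = similar_mat_witD[OF n_def wit]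
  note w2 = similar_mat_witD2[OF w1(5) sim(2)]
  have "stem_jordan_matrix f n_as \<in> carrier_mat n n"
    using stem_jordan_matrix_carrier[of f n_as] w2(5) by auto
  hence "P * B * P' = P * Q * stem_jordan_matrix f n_as * (Q' * P')"
    unfolding B using w1(4-) w2(4-) by (simp add: assoc_mult_mat_dim)
  thus ?thesis using sim similar_mat_wit_trans[OF wit sim(2)] unfolding primary_value_def by blast
qed

text \<open>Transposing \<open>A = Q * J * Q'\<close> leaves the transpose of \<open>J\<close> in
  the middle; conjugation by \<open>R\<close> turns it back into \<open>J\<close> and does the same
  for the image of \<open>J\<close> under \<open>f\<close>.\<close>

lemma primary_value_transpose:
  assumes "primary_value f A B"
  shows "primary_value f (transpose_mat A) (transpose_mat B)"
proof -
  from assms obtain n_as Q Q' where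
    sim: "0 \<notin> fst ` set n_as" "similar_mat_wit A (jordan_matrix n_as) Q Q'" "snd ` set n_as \<subseteq> dom f"
    and B: "B = Q * stem_jordan_matrix f n_as * Q'"
    unfolding primary_value_def by blast
  define n where "n = dim_row A"
  note w = similar_mat_witD[OF n_def sim(2)]
  let ?J = "jordan_matrix n_as" and ?F = "stem_jordan_matrix f n_as"
  have n: "n = sum_list (map fst n_as)" using w(5) by auto
  have F: "?F \<in> carrier_mat n n" using stem_jordan_matrix_carrier[of f n_as] n by simp
  obtain R where R: "similar_mat_wit (transpose_mat ?J) ?J R R" "similar_mat_wit (transpose_mat ?F) ?F R R"
    using jordan_stem_jordan_similar_transpose .
  have "transpose_mat ?J \<in> carrier_mat n n" using w(5) by simp
  note r = similar_mat_witD2[OF this R(1)]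
  have R2: "transpose_mat ?F = R * ?F * R" using similar_mat_witD2(3)[OF _ R(2)] F by auto
  have tr: "transpose_mat (Q * X * Q') = transpose_mat Q' * transpose_mat X * transpose_mat Q"
    if "X \<in> carrier_mat n n" for X
    using that w(6,7) by (simp add: transpose_mult[of _ n n _ n])
  have "transpose_mat Q' * transpose_mat Q = 1\<^sub>m n"
    using transpose_mult[OF w(6,7), symmetric] w(1) by simp
  moreover have "transpose_mat Q * transpose_mat Q' = 1\<^sub>m n"
    using transpose_mult[OF w(7,6), symmetric] w(2) by simp
  ultimately have "similar_mat_wit (transpose_mat A) (transpose_mat ?J) (transpose_mat Q') (transpose_mat Q)"
    using w(4-) tr[OF w(5)] w(3)
    by (intro similar_mat_witI[where n = n]) auto
  from similar_mat_wit_trans[OF this R(1)]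
  have "similar_mat_wit (transpose_mat A) ?J (transpose_mat Q' * R) (R * transpose_mat Q)" .
  moreover have "transpose_mat B = (transpose_mat Q' * R) * ?F * (R * transpose_mat Q)"
    unfolding B tr[OF F] R2 using F r w by (simp add: assoc_mult_mat_dim)
  ultimately show ?thesis using sim unfolding primary_value_def by blast
qed

text \<open>The eigenvalues listed in the Jordan decomposition lie in the domain of
  \<open>f\<close>, so none is 0, and the characteristic polynomial does not vanish at 0.\<close>

lemma primary_value_invertible:
  assumes "A \<in> carrier_mat n n" "primary_value f A B" "f 0 = None"
  shows "invertible_mat A"
proof -
  from assms(2) obtain n_as Q Q' where
    sim: "similar_mat_wit A (jordan_matrix n_as) Q Q'" and dom: "snd ` set n_as \<subseteq> dom f"
    unfolding primary_value_def by blast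
  have "(s, 0) \<notin> set n_as" for s using dom assms(3) by force
  moreover have "char_poly A = (\<Prod>(s, a)\<leftarrow>n_as. [:- a, 1:] ^ s)"
    using char_poly_similar[of A "jordan_matrix n_as"] sim jordan_matrix_char_poly[of n_as]
    unfolding similar_mat_def by auto
  hence "poly (char_poly A) 0 = (\<Prod>(s, a)\<leftarrow>n_as. (- a) ^ s)"
    by (simp add: poly_prod_list o_def case_prod_unfold)
  ultimately have "poly (char_poly A) 0 \<noteq> 0" by (auto simp: prod_list_zero_iff)
  thus ?thesis
    using assms(1) by (simp add: invertible_mat_iff_eigenvalue eigenvalue_root_char_poly)
qed

section \<open>Generalized matrix signs and adjoints\<close>

lemma mats_overD: "A \<in> mats_over K m n \<Longrightarrow> A \<in> carrier_mat m n"
  unfolding mats_over_def by simp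

text \<open>Realness becomes invariance under entrywise conjugation, a form that is inherited by any
  matrix uniquely determined by real data, such as an inverse or a principal square root.\<close>

lemma mats_over_iff:
  assumes "K = \<real> \<or> K = UNIV"
  shows "A \<in> mats_over K m n \<longleftrightarrow> A \<in> carrier_mat m n \<and> (K = \<real> \<longrightarrow> mat_cnj A = A)"
proof -
  have "elements_mat A \<subseteq> \<real> \<longleftrightarrow> (\<forall>i<dim_row A. \<forall>j<dim_col A. cnj (A $$ (i, j)) = A $$ (i, j))"
    unfolding elements_mat_def Reals_cnj_iff[symmetric]
    by (auto simp: UN_subset_iff image_subset_iff)
  also have "\<dots> \<longleftrightarrow> mat_cnj A = A" by (auto simp: mat_eq_iff)
  finally have "elements_mat A \<subseteq> \<real> \<longleftrightarrow> mat_cnj A = A" .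
  \<comment> \<open>For \<open>K = UNIV\<close> the condition on conjugation must be void, which
    requires the two fields to differ; the imaginary unit separates them.\<close>
  moreover have "(UNIV :: complex set) \<noteq> \<real>"
    by (metis UNIV_I complex_is_Real_iff imaginary_unit.sel(2) zero_neq_one)
  ultimately show ?thesis using assms unfolding mats_over_def by auto
qed

lemma mats_over_mult:
  assumes K: "K = \<real> \<or> K = UNIV" and "A \<in> mats_over K l m" "B \<in> mats_over K m n"
  shows "A * B \<in> mats_over K l n"
  using assms(2,3) mat_cnj_mult[of A B] unfolding mats_over_iff[OF K] by auto

lemma mats_over_sharp:
  assumes K: "K = \<real> \<or> K = UNIV" and "A \<in> mats_over K m n"
  shows "sharp k A \<in> mats_over K n m"
proof -
  have "mat_cnj (transpose_mat A) = transpose_mat (mat_cnj A)" by (intro eq_matI) auto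
  thus ?thesis using assms(2) unfolding mats_over_iff[OF K] by (cases k) (auto simp: mat_adjoint_eq)
qed

lemma mats_over_inv:
  assumes K: "K = \<real> \<or> K = UNIV" and A: "A \<in> mats_over K n n" "invertible_mat A"
  shows "mat_inv A \<in> mats_over K n n"
proof -
  have c: "A \<in> carrier_mat n n" using A by (simp add: mats_over_iff[OF K])
  note inv = mat_inv[OF c A(2)]
  have "mat_cnj (mat_inv A) = mat_inv A" if "mat_cnj A = A"
  proof -
    have "A * mat_cnj (mat_inv A) = mat_cnj (A * mat_inv A)"
      using that c inv(1) by (simp add: mat_cnj_mult)
    also have "\<dots> = 1\<^sub>m n" unfolding inv(2) by (intro eq_matI) auto
    finally show ?thesis using mat_inv_eqI[OF c, of "mat_cnj (mat_inv A)"] inv(1) by simp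
  qed
  thus ?thesis using A inv(1) unfolding mats_over_iff[OF K] by simp
qed

lemma mats_over_cnj:
  assumes K: "K = \<real> \<or> K = UNIV" and "A \<in> mats_over K m n"
  shows "mat_cnj A \<in> mats_over K m n"
  using assms(2) unfolding mats_over_iff[OF K] by auto

section \<open>Adjoint conditions cleared of inverses\<close>

lemma adj_carrier:
  assumes "M \<in> carrier_mat m m" "N \<in> carrier_mat n n" "invertible_mat N" "B \<in> carrier_mat m n"
  shows "adj k M N B \<in> carrier_mat n m"
  unfolding adj_def using assms mat_inv(1)[OF assms(2,3)] by (intro carrier_matI) auto

text \<open>Left multiplication by \<open>N\<close> cancels the inverse in the adjoint and is
  reversible. All later adjoint conditions are put into this form.\<close>

lemma adj_eq_iff:
  assumes M: "M \<in> carrier_mat m m" and N: "N \<in> carrier_mat n n" "invertible_mat N"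
    and B: "B \<in> carrier_mat m n" and C: "C \<in> carrier_mat n m"
  shows "adj k M N B = C \<longleftrightarrow> sharp k B * M = N * C"
proof -
  have "N * adj k M N B = N * (mat_inv N * (sharp k B * M))"
    unfolding adj_def using M N(1) B mat_inv(1)[OF N] by (simp add: assoc_mult_mat_dim)
  also have "\<dots> = sharp k B * M"
    using M N(1) B mat_inv[OF N] by (intro mult_inverse_mult_mat) auto
  finally have "sharp k B * M = N * C \<longleftrightarrow> N * adj k M N B = N * C" by auto
  thus ?thesis using mult_mat_left_cancel[OF N adj_carrier[OF M N B] C] by auto
qed

lemma selfadjoint_wrt_iff:
  assumes "N \<in> carrier_mat n n" "invertible_mat N" "A \<in> carrier_mat n n"
  shows "selfadjoint_wrt k N A \<longleftrightarrow> sharp k A * N = N * A"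
  unfolding selfadjoint_wrt_def using assms by (intro adj_eq_iff)

lemma orthonormal_columns_iff:
  assumes M: "M \<in> carrier_mat m m" and N: "N \<in> carrier_mat n n" "invertible_mat N"
    and W: "W \<in> carrier_mat m n"
  shows "orthonormal_columns k M N W \<longleftrightarrow> sharp k W * (M * W) = N"
proof -
  have a: "adj k M N W \<in> carrier_mat n m" using adj_carrier[OF M N W] .
  have "N * (adj k M N W * W) = N * adj k M N W * W"
    using assoc_mult_mat[OF N(1) a W] by simp
  also have "N * adj k M N W = sharp k W * M" using adj_eq_iff[OF M N W a, of k] by simp
  also have "sharp k W * M * W = sharp k W * (M * W)"
    using assoc_mult_mat[OF sharp_carrier[OF W] M W] .
  finally have "N * (adj k M N W * W) = sharp k W * (M * W)" .
  moreover have "adj k M N W * W = 1\<^sub>m n \<longleftrightarrow> N * (adj k M N W * W) = N * 1\<^sub>m n"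
    using mult_mat_left_cancel[OF N _ one_carrier_mat, of "adj k M N W * W"] a W by auto
  ultimately show ?thesis unfolding orthonormal_columns_def using W N by auto
qed

text \<open>Applying \<open>sharp\<close> to the inner adjoint reverses its factors and turns the
  inverse of \<open>N\<close> into that of \<open>sharp k N\<close>; multiplication by
  \<open>M\<close> clears the outer inverse.\<close>

lemma double_adj_iff:
  assumes M: "M \<in> carrier_mat m m" "invertible_mat M" and N: "N \<in> carrier_mat n n" "invertible_mat N"
    and F: "F \<in> carrier_mat m n"
  shows "adj k N M (adj k M N F) = F \<longleftrightarrow>
    sharp k M * (F * (mat_inv (sharp k N) * N)) = M * F"
proof -
  have a: "adj k M N F \<in> carrier_mat n m" using adj_carrier[OF M(1) N F] .
  have "sharp k (adj k M N F) * N = sharp k M * (F * (mat_inv (sharp k N) * N))"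
    unfolding adj_def sharp_invertible(2)[OF N] using M(1) N(1) F mat_inv(1)[OF N]
    by (simp add: sharp_mult assoc_mult_mat_dim)
  thus ?thesis using adj_eq_iff[OF N(1) M a F] by simp
qed

section \<open>Symmetries inherited by the principal square root\<close>

lemma rhp_sqrt_conjugate:
  assumes X: "rhp_sqrt A X" and A: "A \<in> carrier_mat n n"
    and P: "P \<in> carrier_mat n n" "invertible_mat P"
  shows "rhp_sqrt (mat_inv P * A * P) (mat_inv P * X * P)"
proof -
  note p = mat_inv[OF P]
  have X': "X \<in> carrier_mat n n" "X * X = A" "\<And>l. eigenvalue X l \<Longrightarrow> Re l > 0"
    using X A unfolding rhp_sqrt_def by auto
  have "P * (mat_inv P * (X * P)) = X * P"
    using p X' P by (intro mult_inverse_mult_mat) auto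
  moreover have "X * (X * P) = A * P" using X'(1,2) P by (metis assoc_mult_mat)
  ultimately have "mat_inv P * X * P * (mat_inv P * X * P) = mat_inv P * A * P"
    using p X' P A by (simp add: assoc_mult_mat_dim)
  moreover have "similar_mat (mat_inv P * X * P) X"
    using p X' P by (intro similar_matI[of _ _ "mat_inv P" P n]) auto
  ultimately show ?thesis
    unfolding rhp_sqrt_def using p P X' eigenvalue_similar[of "mat_inv P * X * P" X] by auto
qed

text \<open>Conjugation by \<open>P\<close> fixes \<open>A\<close>, so it sends \<open>X\<close> to
  another root of \<open>A\<close> in the right half-plane, which by uniqueness is \<open>X\<close>
  itself.\<close>

lemma rhp_sqrt_commute:
  assumes X: "rhp_sqrt A X" and A: "A \<in> carrier_mat n n"
    and P: "P \<in> carrier_mat n n" "invertible_mat P" and AP: "A * P = P * A"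
  shows "X * P = P * X"
proof -
  note p = mat_inv[OF P]
  have X': "X \<in> carrier_mat n n" using X A unfolding rhp_sqrt_def by auto
  have "mat_inv P * A * P = A"
    using p A P AP mult_inverse_mult_mat[OF p(3), of A] by (simp add: assoc_mult_mat_dim)
  with rhp_sqrt_conjugate[OF X A P] have "rhp_sqrt A (mat_inv P * X * P)" by simp
  with X have "X = mat_inv P * X * P" by (rule rhp_sqrt_unique)
  hence "P * X = P * (mat_inv P * X * P)" by (rule arg_cong)
  also have "\<dots> = P * (mat_inv P * (X * P))" using p X' P by (simp add: assoc_mult_mat_dim)
  also have "\<dots> = X * P" using p X' P by (intro mult_inverse_mult_mat) auto
  finally show ?thesis ..
qed

lemma rhp_sqrt_sharp:
  assumes X: "rhp_sqrt A X" and A: "A \<in> carrier_mat n n"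
  shows "rhp_sqrt (sharp k A) (sharp k X)"
proof -
  have X': "X \<in> carrier_mat n n" "X * X = A" "r_positive_definite X"
    using X A unfolding rhp_sqrt_def r_positive_definite_def by auto
  have "sharp k X * sharp k X = sharp k A" using X' sharp_mult[of X X k] by auto
  thus ?thesis
    using X' A r_positive_definite_sharp[OF X'(1,3)]
    unfolding rhp_sqrt_def r_positive_definite_def by auto
qed

text \<open>The conjugate of a root of a real matrix is again a root with spectrum in the right
  half-plane, so uniqueness makes the root real.\<close>

lemma rhp_sqrt_mats_over:
  assumes K: "K = \<real> \<or> K = UNIV" and A: "A \<in> mats_over K n n" and X: "rhp_sqrt A X"
  shows "X \<in> mats_over K n n"
proof -
  have X': "X \<in> carrier_mat n n" "X * X = A" "\<And>l. eigenvalue X l \<Longrightarrow> Re l > 0"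
    using X A unfolding rhp_sqrt_def mats_over_iff[OF K] by auto
  have "rhp_sqrt (mat_cnj A) (mat_cnj X)"
    unfolding rhp_sqrt_def using X' A mat_cnj_mult[of X X] eigenvalue_mat_cnj[OF X'(1)]
    by (fastforce simp: mats_over_iff[OF K])
  thus ?thesis using rhp_sqrt_unique[OF X, of "mat_cnj X"] A X'(1) unfolding mats_over_iff[OF K] by auto
qed

section \<open>Symmetries of a generalized sign function\<close>

locale matrix_sign =
  fixes K :: "complex set" and n :: nat and \<sigma> :: "complex mat \<rightharpoonup> complex mat"
  assumes field: "K = \<real> \<or> K = UNIV"
    and sign: "generalized_matrix_sign K n \<sigma>"
begin

lemma sign_stem:
  obtains f where "f 0 = None"
    "\<And>A B. A \<in> mats_over K n n \<Longrightarrow> \<sigma> A = Some B \<longleftrightarrow> primary_value f A B"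
  using sign unfolding generalized_matrix_sign_def primary_matrix_function_def by blast

lemma sign_similar:
  assumes "A \<in> mats_over K n n" "\<sigma> A = Some \<Sigma>"
    and "A' \<in> mats_over K n n" "similar_mat_wit A' A P P'"
  shows "\<sigma> A' = Some (P * \<Sigma> * P')"
  using sign_stem assms primary_value_similar by metis

lemma sign_invertible:
  assumes "A \<in> mats_over K n n" "\<sigma> A = Some \<Sigma>"
  shows "invertible_mat A"
  using sign_stem assms primary_value_invertible mats_overD by metis

lemma sign_defined:
  assumes "A \<in> mats_over K n n" "invertible_mat A"
  obtains \<Sigma> where "\<sigma> A = Some \<Sigma>"
  using assms sign unfolding generalized_matrix_sign_def by blast

context
  fixes A \<Sigma> assumes A: "A \<in> mats_over K n n" and \<Sigma>: "\<sigma> A = Some \<Sigma>"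
begin

lemma sign_props:
  shows "\<Sigma> \<in> mats_over K n n" "invertible_mat \<Sigma>" "no_eigenvalue_nonpos_real (\<Sigma> * A)"
    "\<sigma> (mat_cnj A) = Some (mat_cnj \<Sigma>)"
proof -
  have Ai: "invertible_mat A" using sign_invertible[OF A \<Sigma>] .
  show \<Sigma>K: "\<Sigma> \<in> mats_over K n n" and "\<sigma> (mat_cnj A) = Some (mat_cnj \<Sigma>)"
    using sign A Ai \<Sigma> unfolding generalized_matrix_sign_def by auto
  have *: "\<And>l. eigenvalue \<Sigma> l \<Longrightarrow> cmod l = 1"
    "\<And>l. eigenvalue (\<Sigma> * A) l \<Longrightarrow> \<not> (Im l = 0 \<and> Re l < 0)"
    using sign A Ai \<Sigma> unfolding generalized_matrix_sign_def by auto
  have c: "A \<in> carrier_mat n n" "\<Sigma> \<in> carrier_mat n n" using A \<Sigma>K by (auto dest: mats_overD)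
  show \<Sigma>i: "invertible_mat \<Sigma>" using *(1)[of 0] c by (auto simp: invertible_mat_iff_eigenvalue)
  \<comment> \<open>The definition of the sign excludes only negative eigenvalues of
    \<open>\<Sigma> * A\<close>; nonsingularity excludes 0 as well, as a principal square root
    requires.\<close>
  have "invertible_mat (\<Sigma> * A)" using invertible_mat_mult[OF c(2) \<Sigma>i c(1) Ai] by simp
  hence "\<not> eigenvalue (\<Sigma> * A) 0" using c by (simp add: invertible_mat_iff_eigenvalue[of _ n])
  thus "no_eigenvalue_nonpos_real (\<Sigma> * A)"
    using *(2) unfolding no_eigenvalue_nonpos_real_def by (metis complex_eq_iff less_eq_real_def zero_complex.sel)
qed

text \<open>\<open>A\<close> is similar to itself through \<open>A\<close>, so the value
  \<open>\<Sigma>\<close> is fixed under conjugation by \<open>A\<close>.\<close>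

lemma sign_commute: "\<Sigma> * A = A * \<Sigma>"
proof -
  have c: "A \<in> carrier_mat n n" "\<Sigma> \<in> carrier_mat n n"
    using A sign_props(1) by (auto dest: mats_overD)
  note a = mat_inv[OF c(1) sign_invertible[OF A \<Sigma>]]
  have "similar_mat_wit A A A (mat_inv A)"
    using a c by (intro similar_mat_witI[where n = n]) (auto simp: assoc_mult_mat_dim)
  from sign_similar[OF A \<Sigma> A this] have "\<Sigma> = A * \<Sigma> * mat_inv A" using \<Sigma> by simp
  hence "\<Sigma> * A = A * \<Sigma> * mat_inv A * A" by (rule arg_cong)
  also have "\<dots> = A * \<Sigma> * (mat_inv A * A)" using a(1) c by (simp add: assoc_mult_mat_dim)
  also have "\<dots> = A * \<Sigma>" using a c by simp
  finally show ?thesis .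
qed

text \<open>The bilinear kind is compatibility with transposition. The sesquilinear kind applies
  this to the conjugate of \<open>A\<close>, whose sign is known from the conjugation axiom.\<close>

lemma sign_sharp: "\<sigma> (sharp k A) = Some (sharp k \<Sigma>)"
proof -
  have transpose: "\<sigma> (transpose_mat B) = Some (transpose_mat \<Theta>)"
    if "B \<in> mats_over K n n" "\<sigma> B = Some \<Theta>" for B \<Theta>
  proof -
    have "transpose_mat B \<in> mats_over K n n"
      using mats_over_sharp[OF field that(1), of Bilinear] by simp
    thus ?thesis using sign_stem that primary_value_transpose by metis
  qed
  have "mat_cnj (transpose_mat B) = transpose_mat (mat_cnj B)" for B by (intro eq_matI) auto
  thus ?thesis
    using transpose[OF A \<Sigma>] transpose[OF mats_over_cnj[OF field A] sign_props(4)]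
    by (cases k) (auto simp: mat_adjoint_eq)
qed

text \<open>Selfadjointness of \<open>A\<close> says that \<open>sharp k A\<close> is similar to
  \<open>A\<close> through \<open>N\<close>, and the sign respects both \<open>sharp\<close> and
  this similarity.\<close>

lemma sign_selfadjoint:
  assumes N: "N \<in> carrier_mat n n" "invertible_mat N" and sa: "sharp k A * N = N * A"
  shows "sharp k \<Sigma> * N = N * \<Sigma>"
proof -
  have c: "A \<in> carrier_mat n n" "\<Sigma> \<in> carrier_mat n n"
    using A sign_props(1) by (auto dest: mats_overD)
  note inv = mat_inv[OF N]
  have "sharp k A = sharp k A * (N * mat_inv N)" using inv c by simp
  also have "\<dots> = N * A * mat_inv N"
    unfolding sa[symmetric] using c N inv(1) by (simp add: assoc_mult_mat_dim)
  finally have "similar_mat_wit (sharp k A) A N (mat_inv N)"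
    using inv c N by (intro similar_mat_witI[where n = n]) auto
  hence "sharp k \<Sigma> = N * \<Sigma> * mat_inv N"
    using sign_similar[OF A \<Sigma> mats_over_sharp[OF field A]] sign_sharp by simp
  hence "sharp k \<Sigma> * N = N * \<Sigma> * (mat_inv N * N)"
    using c N inv(1) by (simp add: assoc_mult_mat_dim)
  thus ?thesis using c N inv by simp
qed

end

end

section \<open>The generalized polar decomposition\<close>

lemma commute_mat_inv:
  assumes S: "S \<in> carrier_mat n n" "invertible_mat S" and B: "B \<in> carrier_mat n n"
    and SB: "S * B = B * S"
  shows "mat_inv S * B = B * mat_inv S"
proof -
  note s = mat_inv[OF S]
  have "mat_inv S * B = mat_inv S * B * (S * mat_inv S)" using s B by simp
  also have "\<dots> = mat_inv S * (B * S) * mat_inv S" using s(1) S B by (simp add: assoc_mult_mat_dim)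
  also have "\<dots> = mat_inv S * (S * B) * mat_inv S" by (simp only: SB)
  also have "\<dots> = mat_inv S * S * (B * mat_inv S)" using s(1) S B by (simp add: assoc_mult_mat_dim)
  also have "\<dots> = B * mat_inv S" using s B by simp
  finally show ?thesis .
qed

section \<open>The Gram matrix of \<open>F\<close> and the double adjoint\<close>

locale polar_setting = matrix_sign K n \<sigma>
  for K :: "complex set" and n :: nat and \<sigma> :: "complex mat \<rightharpoonup> complex mat" +
  fixes k :: scalar_product_kind and m :: nat and M N F :: "complex mat"
  assumes M: "M \<in> mats_over K m m" "invertible_mat M"
    and N: "N \<in> mats_over K n n" "invertible_mat N"
    and F: "F \<in> mats_over K m n"
begin

definition A :: "complex mat" where "A = adj k M N F * F"

text \<open>The double adjoint of \<open>B\<close> is \<open>M\<^sup>-\<^sup>1 M\<^sup># B V\<close>.\<close>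

definition V :: "complex mat" where "V = mat_inv (sharp k N) * N"

lemma Mc: "M \<in> carrier_mat m m" and Nc: "N \<in> carrier_mat n n" and Fc: "F \<in> carrier_mat m n"
  using M N F mats_overD by auto

lemma A_mats_over: "A \<in> mats_over K n n"
  unfolding A_def adj_def
  by (rule mats_over_mult[OF field mats_over_mult[OF field mats_over_mult[OF field
          mats_over_inv[OF field N] mats_over_sharp[OF field F]] M(1)] F])

lemma Ac: "A \<in> carrier_mat n n"
  using A_mats_over mats_overD by blast

lemma V: "V \<in> carrier_mat n n" "sharp k N * V = N"
proof -
  note inv = mat_inv[OF sharp_carrier[OF Nc, of k] sharp_invertible(1)[OF Nc N(2)]]
  show "V \<in> carrier_mat n n" unfolding V_def using inv Nc by simp
  show "sharp k N * V = N"
    unfolding V_def using inv Nc by (intro mult_inverse_mult_mat) auto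
qed

lemma gram: "N * A = sharp k F * (M * F)"
proof -
  have a: "adj k M N F \<in> carrier_mat n m" by (rule adj_carrier[OF Mc Nc N(2) Fc])
  have "N * A = N * adj k M N F * F" unfolding A_def using a Nc Fc by (simp add: assoc_mult_mat_dim)
  also have "\<dots> = sharp k F * M * F" using adj_eq_iff[OF Mc Nc N(2) Fc a, of k] by simp
  also have "\<dots> = sharp k F * (M * F)" using Mc Fc by (simp add: assoc_mult_mat_dim)
  finally show ?thesis .
qed

lemma double_adj:
  assumes "B \<in> carrier_mat m n"
  shows "adj k N M (adj k M N B) = B \<longleftrightarrow> sharp k M * (B * V) = M * B"
  unfolding V_def using double_adj_iff[OF Mc M(2) Nc N(2) assms] .

text \<open>Applying \<open>sharp\<close> to the selfadjointness equation gives its analogue for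
  \<open>sharp k N\<close>; the two are compared through \<open>sharp k N * V = N\<close>. This
  moves \<open>S\<close> past \<open>V\<close>, so that the double adjoint condition can pass
  between \<open>W\<close> and \<open>F\<close>.\<close>

lemma selfadjoint_commute_V:
  assumes S: "S \<in> carrier_mat n n" and sa: "sharp k S * N = N * S"
  shows "S * V = V * S"
proof -
  have "sharp k N * S = sharp k (sharp k S * N)" using S Nc by (simp add: sharp_mult)
  also have "\<dots> = sharp k S * sharp k N" unfolding sa using S Nc by (simp add: sharp_mult)
  finally have *: "sharp k N * S = sharp k S * sharp k N" .
  have "sharp k N * (S * V) = sharp k N * S * V" using S V(1) Nc by (simp add: assoc_mult_mat_dim)
  also have "\<dots> = sharp k S * sharp k N * V" by (simp only: *)
  also have "\<dots> = sharp k S * (sharp k N * V)" using S V(1) Nc by (simp add: assoc_mult_mat_dim)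
  also have "\<dots> = N * S" by (simp only: V(2) sa)
  also have "\<dots> = sharp k N * V * S" by (simp only: V(2))
  also have "\<dots> = sharp k N * (V * S)" using S V(1) Nc by (simp add: assoc_mult_mat_dim)
  finally show ?thesis
    using mult_mat_left_cancel[OF sharp_carrier[OF Nc] sharp_invertible(1)[OF Nc N(2)],
        of "S * V" n "V * S"] S V(1) by simp
qed

text \<open>Applying \<open>sharp\<close> to the Gram identity replaces \<open>M\<close> by
  \<open>sharp k M\<close>; multiplication by \<open>V\<close> on the right and the double adjoint
  condition on \<open>F\<close> restore \<open>M * F\<close>.\<close>

lemma gram_selfadjoint:
  assumes "adj k N M (adj k M N F) = F"
  shows "sharp k A * N = N * A"
proof -
  have "sharp k A * sharp k N = sharp k (N * A)" using Ac Nc by (simp add: sharp_mult)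
  also have "\<dots> = sharp k F * sharp k M * F"
    unfolding gram using Mc Fc by (simp add: sharp_mult assoc_mult_mat_dim)
  finally have *: "sharp k A * sharp k N = sharp k F * sharp k M * F" .
  have "sharp k A * N = sharp k A * (sharp k N * V)" by (simp only: V(2))
  also have "\<dots> = sharp k A * sharp k N * V" using Ac Nc V(1) by (simp add: assoc_mult_mat_dim)
  also have "\<dots> = sharp k F * sharp k M * F * V" by (simp only: *)
  also have "\<dots> = sharp k F * (sharp k M * (F * V))" using Mc Fc V(1) by (simp add: assoc_mult_mat_dim)
  also have "\<dots> = N * A" using assms double_adj[OF Fc] gram by simp
  finally show ?thesis .
qed

lemma sign_invertible_products:
  assumes "\<sigma> A = Some \<Sigma>"
  shows "\<Sigma> \<in> carrier_mat n n" "invertible_mat \<Sigma>" "mat_inv \<Sigma> \<in> carrier_mat n n"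
    "N * \<Sigma> \<in> carrier_mat n n" "invertible_mat (N * \<Sigma>)"
    "N * mat_inv \<Sigma> \<in> carrier_mat n n" "invertible_mat (N * mat_inv \<Sigma>)"
proof -
  show c: "\<Sigma> \<in> carrier_mat n n" "invertible_mat \<Sigma>"
    using sign_props[OF A_mats_over assms] mats_overD by blast+
  show ci: "mat_inv \<Sigma> \<in> carrier_mat n n" using mat_inv[OF c] by simp
  show "N * \<Sigma> \<in> carrier_mat n n" "N * mat_inv \<Sigma> \<in> carrier_mat n n" using Nc c ci by simp_all
  show "invertible_mat (N * \<Sigma>)" "invertible_mat (N * mat_inv \<Sigma>)"
    using invertible_mat_mult(1)[OF Nc N(2)] c ci invertible_mat_inv(1)[OF c] by blast+
qed

text \<open>All conditions become matrix equations. The translation uses that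
  \<open>N * \<Sigma>\<close> and \<open>N * mat_inv \<Sigma>\<close> are nonsingular, which holds
  once \<open>\<Sigma>\<close> is the sign of \<open>A\<close>.\<close>

lemma polar_decomposition_iff:
  "generalized_polar_decomposition K k m n M N \<sigma> F W S \<longleftrightarrow>
    W \<in> mats_over K m n \<and> S \<in> mats_over K n n \<and> F = W * S \<and>
    (\<exists>\<Sigma>. \<sigma> A = Some \<Sigma> \<and> r_positive_definite S \<and> sharp k S * N = N * S
      \<and> sharp k S * (N * \<Sigma>) = N * \<Sigma> * S \<and> sharp k W * (M * W) = N * mat_inv \<Sigma>
      \<and> sharp k M * (W * V) = M * W)"
proof -
  have "selfadjoint_wrt k N S \<longleftrightarrow> sharp k S * N = N * S" if "S \<in> mats_over K n n"
    using selfadjoint_wrt_iff[OF Nc N(2) mats_overD[OF that]] .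
  moreover have "selfadjoint_wrt k (N * \<Sigma>) S \<longleftrightarrow> sharp k S * (N * \<Sigma>) = N * \<Sigma> * S"
    if "S \<in> mats_over K n n" "\<sigma> A = Some \<Sigma>" for \<Sigma>
    using selfadjoint_wrt_iff[OF sign_invertible_products(4,5)[OF that(2)] mats_overD[OF that(1)]] .
  moreover have "orthonormal_columns k M (N * mat_inv \<Sigma>) W \<longleftrightarrow> sharp k W * (M * W) = N * mat_inv \<Sigma>"
    if "W \<in> mats_over K m n" "\<sigma> A = Some \<Sigma>" for \<Sigma>
    using orthonormal_columns_iff[OF Mc sign_invertible_products(6,7)[OF that(2)] mats_overD[OF that(1)]] .
  moreover have "adj k N M (adj k M N W) = W \<longleftrightarrow> sharp k M * (W * V) = M * W"
    if "W \<in> mats_over K m n"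
    using double_adj[OF mats_overD[OF that]] .
  ultimately show ?thesis
    unfolding generalized_polar_decomposition_def A_def[symmetric] by (auto simp only:)
qed

section \<open>Necessity and the formulas for the factors\<close>

lemma polar_decompositionD:
  assumes "generalized_polar_decomposition K k m n M N \<sigma> F W S"
  shows "invertible_mat A" "adj k N M (adj k M N F) = F"
    "is_principal_sqrt (the (\<sigma> A) * A) S" "W = F * mat_inv S"
proof -
  from assms obtain \<Sigma> where Wc: "W \<in> carrier_mat m n" and Sc: "S \<in> carrier_mat n n"
    and FWS: "F = W * S" and \<Sigma>: "\<sigma> A = Some \<Sigma>" and rpd: "r_positive_definite S"
    and sa: "sharp k S * N = N * S" and sa\<Sigma>: "sharp k S * (N * \<Sigma>) = N * \<Sigma> * S"
    and orth: "sharp k W * (M * W) = N * mat_inv \<Sigma>" and WV: "sharp k M * (W * V) = M * W"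
    unfolding polar_decomposition_iff using mats_overD by blast
  note \<Sigma>c = sign_invertible_products[OF \<Sigma>]
  note si = mat_inv[OF Sc r_positive_definite_invertible[OF Sc rpd]]
  show "invertible_mat A" by (rule sign_invertible[OF A_mats_over \<Sigma>])
  \<comment> \<open>The double adjoint condition on \<open>W\<close> is carried to
    \<open>F = W * S\<close> by commuting \<open>S\<close> with \<open>V\<close>.\<close>
  have "sharp k M * (F * V) = sharp k M * (W * (S * V))"
    unfolding FWS using Wc Sc V(1) by (simp add: assoc_mult_mat_dim)
  also have "\<dots> = sharp k M * (W * (V * S))" by (simp only: selfadjoint_commute_V[OF Sc sa])
  also have "\<dots> = sharp k M * (W * V) * S" using Mc Wc Sc V(1) by (simp add: assoc_mult_mat_dim)
  also have "\<dots> = M * W * S" by (simp only: WV)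
  also have "\<dots> = M * F" unfolding FWS using Mc Wc Sc by (simp add: assoc_mult_mat_dim)
  finally show "adj k N M (adj k M N F) = F" using double_adj[OF Fc] by simp
  \<comment> \<open>The product \<open>sharp k S * N * \<Sigma>\<close> is evaluated by each
    selfadjointness condition in turn; cancelling \<open>N\<close> gives commutation.\<close>
  have "N * (S * \<Sigma>) = N * S * \<Sigma>" using Nc Sc \<Sigma>c(1) by (simp add: assoc_mult_mat_dim)
  also have "\<dots> = sharp k S * N * \<Sigma>" by (simp only: sa)
  also have "\<dots> = sharp k S * (N * \<Sigma>)" using Nc Sc \<Sigma>c(1) by (simp add: assoc_mult_mat_dim)
  also have "\<dots> = N * \<Sigma> * S" by (rule sa\<Sigma>)
  also have "\<dots> = N * (\<Sigma> * S)" using Nc Sc \<Sigma>c(1) by (simp add: assoc_mult_mat_dim)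
  finally have comm: "S * \<Sigma> = \<Sigma> * S"
    using mult_mat_left_cancel[OF Nc N(2), of "S * \<Sigma>" n "\<Sigma> * S"] Sc \<Sigma>c(1) by simp
  have "N * A = sharp k F * (M * F)" by (rule gram)
  also have "\<dots> = sharp k S * (sharp k W * (M * W)) * S"
    unfolding FWS using Mc Wc Sc by (simp add: sharp_mult assoc_mult_mat_dim)
  also have "\<dots> = sharp k S * (N * mat_inv \<Sigma>) * S" by (simp only: orth)
  also have "\<dots> = sharp k S * N * (mat_inv \<Sigma> * S)" using Nc Sc \<Sigma>c(3) by (simp add: assoc_mult_mat_dim)
  also have "\<dots> = N * S * (mat_inv \<Sigma> * S)" by (simp only: sa)
  also have "\<dots> = N * (S * (mat_inv \<Sigma> * S))" using Nc Sc \<Sigma>c(3) by (simp add: assoc_mult_mat_dim)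
  finally have A_eq: "A = S * (mat_inv \<Sigma> * S)"
    using mult_mat_left_cancel[OF Nc N(2) Ac, of "S * (mat_inv \<Sigma> * S)"] Sc \<Sigma>c(3) by simp
  have "\<Sigma> * A = \<Sigma> * S * (mat_inv \<Sigma> * S)" unfolding A_eq using Sc \<Sigma>c(1,3) by (simp add: assoc_mult_mat_dim)
  also have "\<dots> = S * \<Sigma> * (mat_inv \<Sigma> * S)" by (simp only: comm)
  also have "\<dots> = S * (\<Sigma> * mat_inv \<Sigma> * S)" using Sc \<Sigma>c(1,3) by (simp add: assoc_mult_mat_dim)
  also have "\<dots> = S * S" using mat_inv(2)[OF \<Sigma>c(1,2)] Sc by simp
  finally have "rhp_sqrt (\<Sigma> * A) S"
    using Sc \<Sigma>c(1) rpd unfolding rhp_sqrt_def r_positive_definite_def by auto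
  thus "is_principal_sqrt (the (\<sigma> A) * A) S"
    unfolding is_principal_sqrt_def \<Sigma> option.sel
    using sign_props(3)[OF A_mats_over \<Sigma>] rhp_sqrt_unique by blast
  have "F * mat_inv S = W * (S * mat_inv S)" unfolding FWS using Wc Sc si(1) by (simp add: assoc_mult_mat_dim)
  thus "W = F * mat_inv S" using si Wc by simp
qed

section \<open>Construction of a decomposition\<close>

lemma polar_decomposition_exists:
  assumes Ai: "invertible_mat A" and dbl: "adj k N M (adj k M N F) = F"
  shows "\<exists>W S. generalized_polar_decomposition K k m n M N \<sigma> F W S"
proof -
  obtain \<Sigma> where \<Sigma>: "\<sigma> A = Some \<Sigma>" using sign_defined[OF A_mats_over Ai] .
  note \<Sigma>c = sign_invertible_products[OF \<Sigma>]
  note \<Sigma>p = sign_props[OF A_mats_over \<Sigma>]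
  have saA: "sharp k A * N = N * A" by (rule gram_selfadjoint[OF dbl])
  have sa\<Sigma>: "sharp k \<Sigma> * N = N * \<Sigma>" by (rule sign_selfadjoint[OF A_mats_over \<Sigma> Nc N(2) saA])
  have comm: "\<Sigma> * A = A * \<Sigma>" by (rule sign_commute[OF A_mats_over \<Sigma>])
  have \<Sigma>A: "\<Sigma> * A \<in> carrier_mat n n" using \<Sigma>c(1) Ac by simp
  obtain S where S: "rhp_sqrt (\<Sigma> * A) S" using rhp_sqrt_exists[OF \<Sigma>A \<Sigma>p(3)] by blast
  have SK: "S \<in> mats_over K n n"
    using rhp_sqrt_mats_over[OF field mats_over_mult[OF field \<Sigma>p(1) A_mats_over] S] .
  have Sc: "S \<in> carrier_mat n n" using SK by (rule mats_overD)
  have SS: "S * S = \<Sigma> * A" and rpd: "r_positive_definite S"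
    using S unfolding rhp_sqrt_def r_positive_definite_def by auto
  define R where "R = mat_inv S"
  have R: "R \<in> carrier_mat n n" "S * R = 1\<^sub>m n" "R * S = 1\<^sub>m n"
    unfolding R_def using mat_inv[OF Sc r_positive_definite_invertible[OF Sc rpd]] by auto
  have RK: "R \<in> mats_over K n n"
    unfolding R_def by (rule mats_over_inv[OF field SK r_positive_definite_invertible[OF Sc rpd]])
  note Ni = mat_inv[OF Nc N(2)]

  \<comment> \<open>\<open>sharp\<close> reverses the product of two selfadjoint matrices, and
    commutation of \<open>\<Sigma>\<close> with \<open>A\<close> undoes the reversal.\<close>
  have "sharp k (\<Sigma> * A) * N = sharp k A * (sharp k \<Sigma> * N)"
    using Ac \<Sigma>c(1) Nc by (simp add: sharp_mult assoc_mult_mat_dim)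
  also have "\<dots> = sharp k A * (N * \<Sigma>)" by (simp only: sa\<Sigma>)
  also have "\<dots> = sharp k A * N * \<Sigma>" using Ac \<Sigma>c(1) Nc by (simp add: assoc_mult_mat_dim)
  also have "\<dots> = N * A * \<Sigma>" by (simp only: saA)
  also have "\<dots> = N * (A * \<Sigma>)" using Ac \<Sigma>c(1) Nc by (simp add: assoc_mult_mat_dim)
  also have "\<dots> = N * (\<Sigma> * A)" by (simp only: comm)
  finally have "sharp k (\<Sigma> * A) * N = N * (\<Sigma> * A)" .
  hence "adj k N N (\<Sigma> * A) = \<Sigma> * A" using adj_eq_iff[OF Nc Nc N(2) \<Sigma>A \<Sigma>A] by simp
  \<comment> \<open>The \<open>N\<close>-adjoint is \<open>sharp\<close> followed by conjugation
    with \<open>N\<close>, and both send roots in the right half-plane to such roots.\<close>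
  moreover have "rhp_sqrt (adj k N N (\<Sigma> * A)) (adj k N N S)"
    unfolding adj_def
    by (rule rhp_sqrt_conjugate[OF rhp_sqrt_sharp[OF S \<Sigma>A] sharp_carrier[OF \<Sigma>A] Nc N(2)])
  ultimately have "rhp_sqrt (\<Sigma> * A) (adj k N N S)" by simp
  hence "adj k N N S = S" using S by (rule rhp_sqrt_unique)
  hence sa: "sharp k S * N = N * S" using adj_eq_iff[OF Nc Nc N(2) Sc Sc] by simp

  have "\<Sigma> * A * \<Sigma> = \<Sigma> * (\<Sigma> * A)"
    using assoc_mult_mat[OF \<Sigma>c(1) Ac \<Sigma>c(1)] by (simp only: comm)
  from rhp_sqrt_commute[OF S \<Sigma>A \<Sigma>c(1,2) this] have S\<Sigma>: "S * \<Sigma> = \<Sigma> * S" .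
  have "sharp k S * (N * \<Sigma>) = sharp k S * N * \<Sigma>" using Sc Nc \<Sigma>c(1) by (simp add: assoc_mult_mat_dim)
  also have "\<dots> = N * S * \<Sigma>" by (simp only: sa)
  also have "\<dots> = N * (S * \<Sigma>)" using Sc Nc \<Sigma>c(1) by (simp add: assoc_mult_mat_dim)
  also have "\<dots> = N * (\<Sigma> * S)" by (simp only: S\<Sigma>)
  also have "\<dots> = N * \<Sigma> * S" using Sc Nc \<Sigma>c(1) by (simp add: assoc_mult_mat_dim)
  finally have saN\<Sigma>: "sharp k S * (N * \<Sigma>) = N * \<Sigma> * S" .

  define W where "W = F * R"
  have Wc: "W \<in> carrier_mat m n" unfolding W_def using Fc R by simp
  have WK: "W \<in> mats_over K m n" unfolding W_def by (rule mats_over_mult[OF field F RK])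
  have "W * S = F * (R * S)" unfolding W_def using Fc R(1) Sc by (simp add: assoc_mult_mat_dim)
  hence FWS: "F = W * S" using R Fc by simp

  \<comment> \<open>Selfadjointness passes from \<open>S\<close> to its inverse
    \<open>R\<close>.\<close>
  have "sharp k R * sharp k S = 1\<^sub>m n" using R Sc sharp_mult[of S R k] by simp
  hence "N * R = sharp k R * sharp k S * (N * R)" using Nc R(1) by simp
  also have "\<dots> = sharp k R * (sharp k S * N) * R" using Nc R(1) Sc by (simp add: assoc_mult_mat_dim)
  also have "\<dots> = sharp k R * (N * S) * R" by (simp only: sa)
  also have "\<dots> = sharp k R * N * (S * R)" using Nc R(1) Sc by (simp add: assoc_mult_mat_dim)
  also have "\<dots> = sharp k R * N" using R Nc by simp
  finally have saR: "sharp k R * N = N * R" ..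
  have "R * \<Sigma> = \<Sigma> * R"
    unfolding R_def by (rule commute_mat_inv[OF Sc r_positive_definite_invertible[OF Sc rpd] \<Sigma>c(1) S\<Sigma>])
  note R\<Sigma> = this[symmetric]
  \<comment> \<open>Since \<open>R\<close> commutes with \<open>\<Sigma>\<close>, the equation
    \<open>S * S = \<Sigma> * A\<close> identifies \<open>R * A * R\<close> as the inverse of
    \<open>\<Sigma>\<close>, the value needed for the Gram matrix of \<open>W\<close>.\<close>
  have "\<Sigma> * (R * (A * R)) = \<Sigma> * R * (A * R)" using \<Sigma>c(1) R(1) Ac by (simp add: assoc_mult_mat_dim)
  also have "\<dots> = R * \<Sigma> * (A * R)" by (simp only: R\<Sigma>)
  also have "\<dots> = R * (\<Sigma> * A) * R" using \<Sigma>c(1) R(1) Ac by (simp add: assoc_mult_mat_dim)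
  also have "\<dots> = R * (S * S) * R" by (simp only: SS)
  also have "\<dots> = R * S * (S * R)" using R(1) Sc by (simp add: assoc_mult_mat_dim)
  also have "\<dots> = 1\<^sub>m n" using R by simp
  finally have "\<Sigma> * (R * (A * R)) = 1\<^sub>m n" .
  hence RAR: "mat_inv \<Sigma> = R * (A * R)" using \<Sigma>c(1) R(1) Ac by (intro mat_inv_eqI) auto
  have "sharp k W * (M * W) = sharp k R * (sharp k F * (M * F)) * R"
    unfolding W_def using Fc R(1) Mc by (simp add: sharp_mult assoc_mult_mat_dim)
  also have "\<dots> = sharp k R * (N * A) * R" by (simp only: gram)
  also have "\<dots> = sharp k R * N * (A * R)" using Nc R(1) Ac by (simp add: assoc_mult_mat_dim)
  also have "\<dots> = N * R * (A * R)" by (simp only: saR)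
  also have "\<dots> = N * (R * (A * R))" using Nc R(1) Ac by (simp add: assoc_mult_mat_dim)
  also have "\<dots> = N * mat_inv \<Sigma>" by (simp only: RAR)
  finally have orth: "sharp k W * (M * W) = N * mat_inv \<Sigma>" .

  have RV: "R * V = V * R"
    unfolding R_def using selfadjoint_commute_V[OF Sc sa]
    by (rule commute_mat_inv[OF Sc r_positive_definite_invertible[OF Sc rpd] V(1)])
  have "sharp k M * (W * V) = sharp k M * (F * (R * V))"
    unfolding W_def using Fc R(1) V(1) by (simp add: assoc_mult_mat_dim)
  also have "\<dots> = sharp k M * (F * (V * R))" by (simp only: RV)
  also have "\<dots> = sharp k M * (F * V) * R" using Mc Fc R(1) V(1) by (simp add: assoc_mult_mat_dim)
  also have "\<dots> = M * F * R" using dbl double_adj[OF Fc] by simp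
  also have "\<dots> = M * W" unfolding W_def using Mc Fc R(1) by (simp add: assoc_mult_mat_dim)
  finally have WV: "sharp k M * (W * V) = M * W" .

  show ?thesis
    unfolding polar_decomposition_iff using WK SK FWS \<Sigma> rpd sa saN\<Sigma> orth WV by blast
qed

end

theorem theorem5p1:
  fixes K :: "complex set" and k :: scalar_product_kind and m n :: nat
    and M N F :: "complex mat" and \<sigma> :: "complex mat \<rightharpoonup> complex mat"
  assumes "K = \<real> \<or> K = UNIV"
    and "n \<le> m"
    and "M \<in> mats_over K m m" and "invertible_mat M"
    and "N \<in> mats_over K n n" and "invertible_mat N"
    and "generalized_matrix_sign K n \<sigma>"
    and "F \<in> mats_over K m n"
  shows
    "((\<exists>W S. generalized_polar_decomposition K k m n M N \<sigma> F W S) \<longleftrightarrow>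
        invertible_mat (adj k M N F * F) \<and> adj k N M (adj k M N F) = F)
     \<and> (\<forall>W S. generalized_polar_decomposition K k m n M N \<sigma> F W S \<longrightarrow>
          (\<forall>W' S'. generalized_polar_decomposition K k m n M N \<sigma> F W' S' \<longrightarrow> W' = W \<and> S' = S)
          \<and> is_principal_sqrt (the (\<sigma> (adj k M N F * F)) * (adj k M N F * F)) S
          \<and> W = F * mat_inv S)"
proof -
  interpret polar_setting K n \<sigma> k m M N F
    using assms by unfold_locales
  \<comment> \<open>The sign depends on \<open>F\<close> alone, so both \<open>S\<close> and
    \<open>S'\<close> are principal square roots of the same matrix, and each determines its
    \<open>W\<close>.\<close>
  have "W' = W \<and> S' = S"
    if "generalized_polar_decomposition K k m n M N \<sigma> F W S"
      "generalized_polar_decomposition K k m n M N \<sigma> F W' S'" for W S W' S'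
  proof -
    have "S' = S"
      using polar_decompositionD(3)[OF that(1)] polar_decompositionD(3)[OF that(2)]
      unfolding is_principal_sqrt_def by blast
    thus ?thesis using polar_decompositionD(4)[OF that(1)] polar_decompositionD(4)[OF that(2)] by simp
  qed
  thus ?thesis
    unfolding A_def[symmetric] using polar_decompositionD polar_decomposition_exists by blast
qed

end
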